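(* Let $(X,\rho)$ be a metric space and $Q>0$. Assume (1) $(X,\rho)$ is Ahlfors $Q$-regular; (2) there exists $\lambda\in(0,1)$ such that for all $p\in X$ and all $0<r<\operatorname{diam}(X)$ there exist $q_1,q_2\in B_\rho(p,r)$ such that $$\rho(q_1,q_2)\ge\lambda r$$ and $$\rho(p_1,p_2)\le\rho(p_1,q_1)+\rho(p_2,q_2)\qquad\text{for all } p_1,p_2\notin B_\rho(p,r).$$ Then there exists a distance $d$ on $X$ such that (1) $d\le\rho$; (2) $(X,d)$ is Ahlfors $Q$-regular; (3) if $A\subseteq X$ is a subset with $\mathcal{H}^Q_\rho(A)>0$, then $d$ and $\rho$ are not biLipschitz equivalent on $A$.
   Context: A distance means a metric on the set. $B_\rho(p,r)$ is the ball of radius $r$ about $p$ for $\rho$, and $\mathcal{H}^Q_\rho$ is the Hausdorff $Q$-measure with respect to $\rho$. A metric space $(X,d)$ is Ahlfors $Q$-regular if there is $C\ge1$ with $\frac1C r^Q\le \mathcal{H}^Q_d(B_d(x,r))\le C r^Q$ for all $x\in X$ and $0<r<\frac{\operatorname{diam}X}{2}$. Two distances $d,\rho$ are biLipschitz equivalent on $A$ if there is $L\ge1$ with $\frac1L\rho(p,q)\le d(p,q)\le L\rho(p,q)$ for all $p,q\in A$.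
   Formalization: The metric space (X,ρ) is additionally assumed separable; without this the claim fails, e.g. for more than continuum many copies of a Q-regular ultrametric Cantor set of diameter 1/2 at mutual distance 1. *)

theory Defs
  imports "HOL-Analysis.Analysis"
begin

text \<open>Following \<^locale>\<open>Metric_space\<close>, a metric space is a carrier \<open>X\<close> together with a distance function
  \<open>d\<close> of which only the values on \<open>X\<close> matter; balls are the open balls \<^const>\<open>Metric_space.mball\<close>.\<close>

text \<open>Extended-valued, so that unbounded sets have diameter \<open>\<infinity>\<close>; the empty set has diameter \<open>0\<close>.\<close>

definition diam :: "('a \<Rightarrow> 'a \<Rightarrow> real) \<Rightarrow> 'a set \<Rightarrow> ennreal" where
  "diam d A = (SUP x\<in>A. SUP y\<in>A. ennreal (d x y))"

text \<open>Every set of a \<open>\<delta>\<close>-cover has finite diameter, so \<^const>\<open>enn2real\<close> loses nothing here.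
  If \<open>A\<close> has no countable \<open>\<delta>\<close>-cover the infimum is \<open>\<infinity>\<close>. Covers by finitely many sets are included,
  since for \<open>Q > 0\<close> an empty set contributes \<open>0 powr Q = 0\<close>.\<close>

definition hausdorff_pre ::
  "'a set \<Rightarrow> ('a \<Rightarrow> 'a \<Rightarrow> real) \<Rightarrow> real \<Rightarrow> real \<Rightarrow> 'a set \<Rightarrow> ennreal" where
  "hausdorff_pre X d Q \<delta> A =
     (INF S \<in> {S :: nat \<Rightarrow> 'a set. (\<forall>i. S i \<subseteq> X \<and> diam d (S i) \<le> ennreal \<delta>) \<and> A \<subseteq> (\<Union>i. S i)}.
        \<Sum>i. ennreal (enn2real (diam d (S i)) powr Q))"

text \<open>Defined as an outer measure, on arbitrary subsets of \<open>X\<close>.\<close>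

definition hausdorff :: "'a set \<Rightarrow> ('a \<Rightarrow> 'a \<Rightarrow> real) \<Rightarrow> real \<Rightarrow> 'a set \<Rightarrow> ennreal" where
  "hausdorff X d Q A = (SUP \<delta>\<in>{0<..}. hausdorff_pre X d Q \<delta> A)"

text \<open>For bounded \<open>X\<close> this range of radii does not force \<open>X\<close> to be separable (consider an uncountable
  disjoint union of copies of a compact regular space, at large mutual distance); separability,
  without which \<open>\<H>\<^sup>Q\<close> is infinite on uncountable uniformly discrete sets, has to be assumed
  on its own.\<close>

definition ahlfors_regular :: "'a set \<Rightarrow> ('a \<Rightarrow> 'a \<Rightarrow> real) \<Rightarrow> real \<Rightarrow> bool" where
  "ahlfors_regular X d Q \<longleftrightarrow>
     (\<exists>C\<ge>1. \<forall>x\<in>X. \<forall>r>0. ennreal r < diam d X / 2 \<longrightarrow>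
        ennreal (1 / C * r powr Q) \<le> hausdorff X d Q (Metric_space.mball X d x r) \<and>
        hausdorff X d Q (Metric_space.mball X d x r) \<le> ennreal (C * r powr Q))"

definition bilipschitz_equivalent_on ::
  "'a set \<Rightarrow> ('a \<Rightarrow> 'a \<Rightarrow> real) \<Rightarrow> ('a \<Rightarrow> 'a \<Rightarrow> real) \<Rightarrow> bool" where
  "bilipschitz_equivalent_on A d \<rho> \<longleftrightarrow>
     (\<exists>L\<ge>1. \<forall>p\<in>A. \<forall>q\<in>A. 1 / L * \<rho> p q \<le> d p q \<and> d p q \<le> L * \<rho> p q)"

end

theory Submission
  imports Defs
begin

text \<open>Choose rapidly decreasing scales and, at each scale \<open>s\<close>, a net of points that stay away from the
  shortcuts made at coarser scales; near each net point the hypothesis provides a pair of points at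
  distance comparable to \<open>s\<close>, and \<open>d\<close> is the largest distance below \<open>\<rho>\<close> for which these pairs are much
  closer than \<open>s\<close>. It is described dually: \<open>d x y\<close> is the supremum of \<open>\<bar>f x - f y\<bar>\<close> over all 1-Lipschitz \<open>f\<close>
  that vary little across every shortcut.

  The second half of the hypothesis says that a shortcut is useless for points outside its ball. Hence
  a 1-Lipschitz function can be made constant on the shortcuts of one scale by changing it inside their
  balls only, in particular without disturbing coarser shortcuts. Treating all finer scales in this way
  turns a function adapted to the scales above \<open>r\<close> into an admissible one at the cost of an error
  \<open>O(r)\<close>. Since at most one of the coarser shortcuts can be reached within distance \<open>r\<close>, it follows
  that a \<open>d\<close>-ball of radius \<open>r\<close> lies in two \<open>\<rho>\<close>-balls of radius \<open>O(r)\<close>, so \<open>\<H>\<^sup>Q\<close> for \<open>d\<close> and \<open>\<rho>\<close>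
  are comparable and \<open>d\<close> is regular.

  If \<open>d\<close> and \<open>\<rho>\<close> are biLipschitz equivalent on \<open>A\<close>, then for each small scale \<open>s\<close> and each shortcut, \<open>A\<close>
  misses a ball of radius comparable to \<open>s\<close> about one endpoint. The union of these holes near a bounded
  part of \<open>A\<close> has measure at least a constant times that of this part. Holes of different scales lie at
  different distances from \<open>A\<close>, hence are positively separated; their measures add up to a finite total
  although there are infinitely many scales, so \<open>A\<close> is a null set.\<close>

subsection \<open>Hausdorff measure\<close>

lemma diam_empty [simp]: "diam d {} = 0"
  by (simp add: diam_def bot_ennreal)

lemma diam_mono: "A \<subseteq> B \<Longrightarrow> diam d A \<le> diam d B"
  unfolding diam_def by (meson SUP_mono SUP_subset_mono order_refl)

lemma diam_upper: "x \<in> A \<Longrightarrow> y \<in> A \<Longrightarrow> ennreal (d x y) \<le> diam d A"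
  unfolding diam_def by (meson SUP_upper2 SUP_upper)

lemma diam_le_cong:
  assumes "\<And>x y. x \<in> A \<Longrightarrow> y \<in> A \<Longrightarrow> d x y \<le> \<rho> x y"
  shows "diam d A \<le> diam \<rho> A"
  unfolding diam_def using assms by (intro SUP_mono) (meson ennreal_leI SUP_mono)

definition hausdorff_covers :: "'a set \<Rightarrow> ('a \<Rightarrow> 'a \<Rightarrow> real) \<Rightarrow> real \<Rightarrow> 'a set \<Rightarrow> (nat \<Rightarrow> 'a set) set" where
  "hausdorff_covers X d \<delta> A = {S. (\<forall>i. S i \<subseteq> X \<and> diam d (S i) \<le> ennreal \<delta>) \<and> A \<subseteq> (\<Union>i. S i)}"

lemma hausdorff_pre_alt:
  "hausdorff_pre X d Q \<delta> A =
     (INF S \<in> hausdorff_covers X d \<delta> A. \<Sum>i. ennreal (enn2real (diam d (S i)) powr Q))"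
  by (simp add: hausdorff_pre_def hausdorff_covers_def)

lemma hausdorff_pre_antimono:
  assumes "\<delta> \<le> \<epsilon>" shows "hausdorff_pre X d Q \<epsilon> A \<le> hausdorff_pre X d Q \<delta> A"
proof -
  have "hausdorff_covers X d \<delta> A \<subseteq> hausdorff_covers X d \<epsilon> A"
    unfolding hausdorff_covers_def using assms by (auto intro: order_trans ennreal_leI)
  then show ?thesis
    unfolding hausdorff_pre_alt by (rule INF_superset_mono) simp
qed

lemma hausdorff_pre_le_hausdorff: "\<delta> > 0 \<Longrightarrow> hausdorff_pre X d Q \<delta> A \<le> hausdorff X d Q A"
  unfolding hausdorff_def by (rule SUP_upper) simp

lemma hausdorff_mono:
  assumes "A \<subseteq> B" shows "hausdorff X d Q A \<le> hausdorff X d Q B"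
proof -
  have "hausdorff_pre X d Q \<delta> A \<le> hausdorff_pre X d Q \<delta> B" for \<delta>
    unfolding hausdorff_pre_alt
    by (rule INF_superset_mono) (use assms in \<open>auto simp: hausdorff_covers_def\<close>)
  then show ?thesis
    unfolding hausdorff_def by (intro SUP_mono) auto
qed

text \<open>The constant sequence \<open>A\<close> is a cover at every scale, and each of its terms
  is \<open>0 powr Q\<close>, which is \<open>0\<close> in HOL.\<close>

lemma hausdorff_eq_0_if_diam_eq_0:
  assumes "A \<subseteq> X" "diam d A = 0"
  shows "hausdorff X d Q A = 0"
proof -
  define S where "S = (\<lambda>i::nat. A)"
  have "hausdorff_pre X d Q \<delta> A \<le> 0" if "\<delta> > 0" for \<delta>
  proof -
    have "S \<in> hausdorff_covers X d \<delta> A"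
      using assms by (auto simp: hausdorff_covers_def S_def)
    then have "hausdorff_pre X d Q \<delta> A \<le> (\<Sum>i. ennreal (enn2real (diam d (S i)) powr Q))"
      unfolding hausdorff_pre_alt by (rule INF_lower)
    also have "\<dots> = 0" by (simp add: S_def assms)
    finally show ?thesis .
  qed
  then have "hausdorff X d Q A \<le> 0"
    unfolding hausdorff_def by (intro SUP_least) auto
  then show ?thesis by simp
qed

lemma hausdorff_empty [simp]: "hausdorff X d Q {} = 0"
  by (rule hausdorff_eq_0_if_diam_eq_0) auto

text \<open>The usual argument: covers of the \<open>A n\<close> that are optimal up to
  \<open>e / 2 ^ Suc n\<close> are merged into one sequence by \<open>prod_decode\<close>.\<close>

lemma hausdorff_pre_countably_subadditive:
  "hausdorff_pre X d Q \<delta> (\<Union>i::nat. A i) \<le> (\<Sum>i. hausdorff_pre X d Q \<delta> (A i))"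
proof (rule ennreal_le_epsilon)
  let ?H = "hausdorff_pre X d Q \<delta>"
  let ?f = "\<lambda>S. ennreal (enn2real (diam d S) powr Q)"
  fix e :: real assume e: "0 < e" and fin: "(\<Sum>i. ?H (A i)) < top"
  have "\<exists>S \<in> hausdorff_covers X d \<delta> (A n). (\<Sum>i. ?f (S i)) < ?H (A n) + ennreal (e * (1/2) ^ Suc n)" for n
  proof (rule INF_approx_ennreal)
    show "?H (A n) \<noteq> \<infinity>"
      using ennreal_suminf_lessD[OF fin, of n] by auto
  qed (use e in \<open>auto simp: hausdorff_pre_alt\<close>)
  then obtain B where B: "\<And>n. B n \<in> hausdorff_covers X d \<delta> (A n)"
    and Ble: "\<And>n. (\<Sum>i. ?f (B n i)) < ?H (A n) + ennreal (e * (1/2) ^ Suc n)"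
    by metis
  define C where "C = case_prod B \<circ> prod_decode"
  have "(\<Union>i. A i) \<subseteq> (\<Union>i. C i)"
  proof
    fix x assume "x \<in> (\<Union>i. A i)"
    then obtain n where "x \<in> A n" by auto
    then obtain i where "x \<in> B n i" using B[of n] by (auto simp: hausdorff_covers_def)
    then have "x \<in> C (prod_encode (n, i))" by (simp add: C_def)
    then show "x \<in> (\<Union>i. C i)" by blast
  qed
  then have "C \<in> hausdorff_covers X d \<delta> (\<Union>i. A i)"
    using B by (auto simp: hausdorff_covers_def C_def split_def)
  then have "?H (\<Union>i. A i) \<le> (\<Sum>i. ?f (C i))"
    unfolding hausdorff_pre_alt by (rule INF_lower)
  also have "\<dots> = (\<Sum>n. \<Sum>i. ?f (B n i))"
    unfolding C_def comp_def split_def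
    by (rule suminf_ennreal_2dimen[where f = "\<lambda>p. ?f (B (fst p) (snd p))"]) simp
  also have "\<dots> \<le> (\<Sum>n. ?H (A n) + ennreal (e * (1/2) ^ Suc n))"
    by (intro suminf_le less_imp_le[OF Ble]) auto
  also have "\<dots> = (\<Sum>n. ?H (A n)) + (\<Sum>n. ennreal e * ennreal ((1/2) ^ Suc n))"
    using e by (subst suminf_add[symmetric])
               (auto simp del: ennreal_suminf_cmult simp add: ennreal_mult[symmetric])
  also have "\<dots> = (\<Sum>n. ?H (A n)) + e"
    unfolding ennreal_suminf_cmult
    by (subst suminf_ennreal_eq[OF zero_le_power power_half_series]) auto
  finally show "?H (\<Union>i. A i) \<le> (\<Sum>n. ?H (A n)) + e" .
qed

lemma hausdorff_countably_subadditive: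
  "hausdorff X d Q (\<Union>i::nat. A i) \<le> (\<Sum>i. hausdorff X d Q (A i))"
  unfolding hausdorff_def[of _ _ _ "\<Union>i. A i"]
proof (rule SUP_least)
  fix \<delta> :: real assume "\<delta> \<in> {0<..}"
  then have "(\<Sum>i. hausdorff_pre X d Q \<delta> (A i)) \<le> (\<Sum>i. hausdorff X d Q (A i))"
    by (intro suminf_le hausdorff_pre_le_hausdorff) auto
  then show "hausdorff_pre X d Q \<delta> (\<Union>i. A i) \<le> (\<Sum>i. hausdorff X d Q (A i))"
    using hausdorff_pre_countably_subadditive[of X d Q \<delta> A] by (rule order_trans[rotated])
qed

lemma hausdorff_Un_le: "hausdorff X d Q (A \<union> B) \<le> hausdorff X d Q A + hausdorff X d Q B"
proof -
  let ?S = "\<lambda>i::nat. if i = 0 then A else if i = 1 then B else {}"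
  have "(\<Union>i. ?S i) = A \<union> B"
    by (auto split: if_splits)
  moreover have "(\<Sum>i. hausdorff X d Q (?S i)) = (\<Sum>i\<in>{0,1}. hausdorff X d Q (?S i))"
    by (rule suminf_finite) auto
  ultimately show ?thesis
    using hausdorff_countably_subadditive[of X d Q ?S] by simp
qed

lemma hausdorff_finite_UN_le:
  "finite I \<Longrightarrow> hausdorff X d Q (\<Union>i\<in>I. A i) \<le> (\<Sum>i\<in>I. hausdorff X d Q (A i))"
proof (induction I rule: finite_induct)
  case (insert x F)
  have "hausdorff X d Q (\<Union>i\<in>insert x F. A i) \<le> hausdorff X d Q (A x) + hausdorff X d Q (\<Union>i\<in>F. A i)"
    using hausdorff_Un_le[of X d Q "A x" "\<Union>i\<in>F. A i"] by simp
  also have "\<dots> \<le> hausdorff X d Q (A x) + (\<Sum>i\<in>F. hausdorff X d Q (A i))"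
    by (intro add_mono insert.IH order_refl)
  finally show ?case using insert.hyps by simp
qed simp

lemma hausdorff_le_cong:
  assumes le: "\<And>x y. x \<in> X \<Longrightarrow> y \<in> X \<Longrightarrow> d x y \<le> \<rho> x y" and "Q > 0"
  shows "hausdorff X d Q A \<le> hausdorff X \<rho> Q A"
proof -
  have diam_le: "diam d S \<le> diam \<rho> S" if "S \<subseteq> X" for S
    using that by (intro diam_le_cong le) auto
  have "hausdorff_pre X d Q \<delta> A \<le> hausdorff_pre X \<rho> Q \<delta> A" for \<delta>
    unfolding hausdorff_pre_alt
  proof (rule INF_mono)
    fix S assume S: "S \<in> hausdorff_covers X \<rho> \<delta> A"
    have "S \<in> hausdorff_covers X d \<delta> A"
      using S diam_le unfolding hausdorff_covers_def by (auto intro: order_trans)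
    moreover have "(\<Sum>i. ennreal (enn2real (diam d (S i)) powr Q)) \<le> (\<Sum>i. ennreal (enn2real (diam \<rho> (S i)) powr Q))"
    proof (intro suminf_le ennreal_leI powr_mono2 enn2real_mono)
      fix i
      show "diam d (S i) \<le> diam \<rho> (S i)"
        using S by (intro diam_le) (auto simp: hausdorff_covers_def)
      \<comment> \<open>Finiteness matters here: \<open>enn2real\<close> sends infinity to
        \<open>0\<close> and is monotone only below it.\<close>
      have "diam \<rho> (S i) \<le> ennreal \<delta>" using S by (auto simp: hausdorff_covers_def)
      then show "diam \<rho> (S i) < top" by (metis ennreal_less_top le_less_trans)
    qed (use \<open>Q > 0\<close> in auto)
    ultimately show "\<exists>S'\<in>hausdorff_covers X d \<delta> A.
      (\<Sum>i. ennreal (enn2real (diam d (S' i)) powr Q)) \<le> (\<Sum>i. ennreal (enn2real (diam \<rho> (S i)) powr Q))"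
      by blast
  qed
  then show ?thesis
    unfolding hausdorff_def by (intro SUP_mono) auto
qed

section \<open>Additivity over positively separated sets\<close>

text \<open>A set of diameter below \<open>\<eta>\<close> cannot meet both \<open>A\<close> and
  \<open>B\<close>, so the members of a cover of the union that meet \<open>A\<close> and those that
  meet \<open>B\<close> have disjoint index sets.\<close>

lemma hausdorff_pre_superadditive:
  assumes "\<eta> > 0" and "\<delta> < \<eta>" and sep: "\<And>a b. a \<in> A \<Longrightarrow> b \<in> B \<Longrightarrow> \<eta> \<le> d a b"
  shows "hausdorff_pre X d Q \<delta> A + hausdorff_pre X d Q \<delta> B \<le> hausdorff_pre X d Q \<delta> (A \<union> B)"
  unfolding hausdorff_pre_alt[of _ _ _ _ "A \<union> B"]
proof (rule INF_greatest)
  let ?f = "\<lambda>S. ennreal (enn2real (diam d S) powr Q)"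
  fix S assume S: "S \<in> hausdorff_covers X d \<delta> (A \<union> B)"
  define SA where "SA = (\<lambda>i. if S i \<inter> A \<noteq> {} then S i else {})"
  define SB where "SB = (\<lambda>i. if S i \<inter> B \<noteq> {} then S i else {})"
  have disj: "S i \<inter> A = {} \<or> S i \<inter> B = {}" for i
  proof (rule ccontr)
    assume "\<not> ?thesis"
    then obtain a b where ab: "a \<in> A" "b \<in> B" "a \<in> S i" "b \<in> S i" by blast
    have "ennreal \<eta> \<le> ennreal (d a b)" using sep[OF ab(1,2)] by (rule ennreal_leI)
    also have "\<dots> \<le> diam d (S i)" using ab by (intro diam_upper)
    also have "\<dots> \<le> ennreal \<delta>" using S by (simp add: hausdorff_covers_def)
    finally show False using assms(1,2) by (simp add: ennreal_le_iff2)
  qed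
  have sub: "SA i \<subseteq> S i" "SB i \<subseteq> S i" for i by (auto simp: SA_def SB_def)
  have cov: "T \<in> hausdorff_covers X d \<delta> Y" if "\<And>i. T i \<subseteq> S i" "Y \<subseteq> (\<Union>i. T i)" for T Y
    unfolding hausdorff_covers_def mem_Collect_eq
  proof (intro conjI allI that(2))
    fix i
    show "T i \<subseteq> X" using that(1)[of i] S unfolding hausdorff_covers_def by blast
    show "diam d (T i) \<le> ennreal \<delta>"
      using diam_mono[OF that(1)[of i], of d] S unfolding hausdorff_covers_def
      by (auto intro: order_trans)
  qed
  have "A \<subseteq> (\<Union>i. SA i)" "B \<subseteq> (\<Union>i. SB i)"
    using S unfolding hausdorff_covers_def SA_def SB_def by (fastforce split: if_splits)+
  then have "SA \<in> hausdorff_covers X d \<delta> A" "SB \<in> hausdorff_covers X d \<delta> B"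
    by (simp_all only: cov sub)
  then have "hausdorff_pre X d Q \<delta> A + hausdorff_pre X d Q \<delta> B \<le> (\<Sum>i. ?f (SA i)) + (\<Sum>i. ?f (SB i))"
    unfolding hausdorff_pre_alt by (intro add_mono INF_lower)
  also have "\<dots> = (\<Sum>i. ?f (SA i) + ?f (SB i))"
    by (rule suminf_add) auto
  also have "\<dots> \<le> (\<Sum>i. ?f (S i))"
  proof (intro suminf_le)
    show "?f (SA i) + ?f (SB i) \<le> ?f (S i)" for i
      using disj[of i] by (auto simp: SA_def SB_def)
  qed auto
  finally show "hausdorff_pre X d Q \<delta> A + hausdorff_pre X d Q \<delta> B \<le> (\<Sum>i. ?f (S i))" .
qed

text \<open>The metric outer measure property. It takes the place of measurability: the porosity
  argument only adds up measures of positively separated sets.\<close>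

lemma hausdorff_superadditive:
  assumes "\<eta> > 0" and sep: "\<And>a b. a \<in> A \<Longrightarrow> b \<in> B \<Longrightarrow> \<eta> \<le> d a b"
  shows "hausdorff X d Q A + hausdorff X d Q B \<le> hausdorff X d Q (A \<union> B)"
proof -
  let ?H = "\<lambda>\<delta> A. hausdorff_pre X d Q \<delta> A"
  have "hausdorff X d Q A + hausdorff X d Q B = (SUP \<delta>\<in>{0<..}. ?H \<delta> A + ?H \<delta> B)"
    unfolding hausdorff_def
  proof (rule SUP_add_directed_ennreal[symmetric])
    fix i j :: real assume "i \<in> {0<..}" "j \<in> {0<..}"
    then show "\<exists>k\<in>{0<..}. ?H i A + ?H j B \<le> ?H k A + ?H k B"
      by (intro bexI[of _ "min i j"] add_mono hausdorff_pre_antimono) auto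
  qed
  also have "\<dots> \<le> hausdorff X d Q (A \<union> B)"
  proof (rule SUP_least)
    fix \<delta> :: real assume \<delta>: "\<delta> \<in> {0<..}"
    define \<epsilon> where "\<epsilon> = min \<delta> (\<eta> / 2)"
    have \<epsilon>: "0 < \<epsilon>" "\<epsilon> < \<eta>" "\<epsilon> \<le> \<delta>" using \<delta> \<open>\<eta> > 0\<close> by (auto simp: \<epsilon>_def)
    have "?H \<delta> A + ?H \<delta> B \<le> ?H \<epsilon> A + ?H \<epsilon> B"
      by (intro add_mono hausdorff_pre_antimono \<epsilon>)
    also have "\<dots> \<le> ?H \<epsilon> (A \<union> B)"
      using \<epsilon> \<open>\<eta> > 0\<close> sep by (intro hausdorff_pre_superadditive)
    also have "\<dots> \<le> hausdorff X d Q (A \<union> B)"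
      by (rule hausdorff_pre_le_hausdorff[OF \<epsilon>(1)])
    finally show "?H \<delta> A + ?H \<delta> B \<le> hausdorff X d Q (A \<union> B)" .
  qed
  finally show ?thesis .
qed

lemma hausdorff_finite_UN_superadditive:
  assumes "finite I"
    and sep: "\<And>i j. i \<in> I \<Longrightarrow> j \<in> I \<Longrightarrow> i \<noteq> j \<Longrightarrow> \<exists>\<eta>>0. \<forall>a\<in>A i. \<forall>b\<in>A j. \<eta> \<le> d a b"
  shows "(\<Sum>i\<in>I. hausdorff X d Q (A i)) \<le> hausdorff X d Q (\<Union>i\<in>I. A i)"
  using assms
proof (induction I rule: finite_induct)
  case (insert x F)
  have "\<forall>j\<in>F. \<exists>\<eta>>0. \<forall>a\<in>A x. \<forall>b\<in>A j. \<eta> \<le> d a b"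
    using insert.hyps by (intro ballI insert.prems) auto
  then obtain \<eta> where \<eta>: "\<And>j. j \<in> F \<Longrightarrow> \<eta> j > 0"
    "\<And>j a b. j \<in> F \<Longrightarrow> a \<in> A x \<Longrightarrow> b \<in> A j \<Longrightarrow> \<eta> j \<le> d a b"
    by metis
  \<comment> \<open>The inserted \<open>1\<close> keeps the minimum meaningful when \<open>F\<close>
    is empty.\<close>
  define \<eta>0 where "\<eta>0 = Min (insert 1 (\<eta> ` F))"
  have "\<eta>0 > 0" using insert.hyps \<eta>(1) by (auto simp: \<eta>0_def)
  moreover have "\<eta>0 \<le> \<eta> j" if "j \<in> F" for j
    using that insert.hyps by (auto simp: \<eta>0_def)
  ultimately have "hausdorff X d Q (A x) + hausdorff X d Q (\<Union>i\<in>F. A i) \<le> hausdorff X d Q (A x \<union> (\<Union>i\<in>F. A i))"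
    using \<eta>(2) by (intro hausdorff_superadditive[of \<eta>0]) (meson UN_E order_trans)+
  moreover have "(\<Sum>i\<in>F. hausdorff X d Q (A i)) \<le> hausdorff X d Q (\<Union>i\<in>F. A i)"
    by (intro insert.IH insert.prems) auto
  ultimately show ?case
    using insert.hyps by (simp add: order_trans[OF add_left_mono])
qed simp

text \<open>A mass distribution principle, with the outer measure for \<open>\<rho>\<close> in the
  role of the mass: sum the assumed bound over a cover that is fine for \<open>d\<close>.\<close>

lemma hausdorff_le_if_small_sets:
  assumes "\<delta> > 0" "C > 0"
    and small: "\<And>S. S \<subseteq> X \<Longrightarrow> diam d S \<le> ennreal \<delta> \<Longrightarrow>
                  hausdorff X \<rho> Q S \<le> ennreal (C * enn2real (diam d S) powr Q)"
  shows "hausdorff X \<rho> Q A \<le> ennreal C * hausdorff X d Q A"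
proof -
  let ?f = "\<lambda>S. ennreal (enn2real (diam d S) powr Q)"
  \<comment> \<open>Dividing by \<open>C\<close> first gives a lower bound for each member of the
    infimum, so the constant need not be moved through it.\<close>
  have le: "hausdorff X \<rho> Q A / ennreal C \<le> (\<Sum>i. ?f (S i))" if S: "S \<in> hausdorff_covers X d \<delta> A" for S
  proof -
    have "hausdorff X \<rho> Q A \<le> hausdorff X \<rho> Q (\<Union>i. S i)"
      using S by (intro hausdorff_mono) (auto simp: hausdorff_covers_def)
    also have "\<dots> \<le> (\<Sum>i. hausdorff X \<rho> Q (S i))"
      by (rule hausdorff_countably_subadditive)
    also have "\<dots> \<le> (\<Sum>i. ennreal C * ?f (S i))"
    proof (intro suminf_le)
      fix i
      have "hausdorff X \<rho> Q (S i) \<le> ennreal (C * enn2real (diam d (S i)) powr Q)"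
        using S by (intro small) (auto simp: hausdorff_covers_def)
      then show "hausdorff X \<rho> Q (S i) \<le> ennreal C * ?f (S i)"
        using \<open>C > 0\<close> by (simp add: ennreal_mult)
    qed auto
    finally have "hausdorff X \<rho> Q A \<le> ennreal C * (\<Sum>i. ?f (S i))" by simp
    then show ?thesis
      using \<open>C > 0\<close> by (intro divide_le_posI_ennreal) auto
  qed
  have "hausdorff X \<rho> Q A = ennreal C * (hausdorff X \<rho> Q A / ennreal C)"
    using \<open>C > 0\<close> by (simp add: ennreal_times_divide mult_divide_eq_ennreal mult.commute[of "ennreal C"])
  also have "\<dots> \<le> ennreal C * hausdorff_pre X d Q \<delta> A"
    unfolding hausdorff_pre_alt by (intro mult_left_mono INF_greatest le) auto
  also have "\<dots> \<le> ennreal C * hausdorff X d Q A"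
    by (intro mult_left_mono hausdorff_pre_le_hausdorff assms) auto
  finally show ?thesis .
qed

subsection \<open>Separated sets and 1-Lipschitz functions\<close>

text \<open>Zorn's lemma: a point of \<open>Y\<close> at distance at least \<open>s\<close> from all
  of \<open>P\<close> could be added to \<open>P\<close>.\<close>

lemma (in Metric_space) maximal_separated_subset:
  assumes "s > 0" "Y \<subseteq> M"
  shows "\<exists>P. P \<subseteq> Y \<and> (\<forall>x\<in>P. \<forall>y\<in>P. x \<noteq> y \<longrightarrow> s \<le> d x y) \<and> (\<forall>y\<in>Y. \<exists>p\<in>P. d y p < s)"
proof -
  define \<P> where "\<P> = {P. P \<subseteq> Y \<and> (\<forall>x\<in>P. \<forall>y\<in>P. x \<noteq> y \<longrightarrow> s \<le> d x y)}"
  have "\<exists>P\<in>\<P>. \<forall>P'\<in>\<P>. P \<subseteq> P' \<longrightarrow> P' = P"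
  proof (rule subset_Zorn')
    fix \<C> assume chain: "subset.chain \<P> \<C>"
    have "s \<le> d x y" if xy: "x \<in> \<Union>\<C>" "y \<in> \<Union>\<C>" "x \<noteq> y" for x y
    proof -
      from xy(1,2) obtain S T where "S \<in> \<C>" "x \<in> S" "T \<in> \<C>" "y \<in> T" by (elim UnionE)
      then obtain U where "U \<in> \<C>" "x \<in> U" "y \<in> U"
        using chain unfolding subset_chain_def by (metis (no_types, lifting) in_mono)
      then show ?thesis using chain xy unfolding subset_chain_def \<P>_def by blast
    qed
    then show "\<Union>\<C> \<in> \<P>"
      using chain unfolding subset_chain_def \<P>_def by blast
  qed
  then obtain P where P: "P \<in> \<P>" and max: "\<And>P'. P' \<in> \<P> \<Longrightarrow> P \<subseteq> P' \<Longrightarrow> P' = P" by blast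
  have "\<exists>p\<in>P. d y p < s" if y: "y \<in> Y" for y
  proof (rule ccontr)
    assume *: "\<not> ?thesis"
    then have "s \<le> d y p" "s \<le> d p y" if "p \<in> P" for p
      using that by (force simp: commute)+
    then have "insert y P \<in> \<P>"
      using P y unfolding \<P>_def by auto
    then have "y \<in> P" using max by blast
    with * show False using assms y by (force intro: bexI[of _ y])
  qed
  moreover have "P \<subseteq> Y \<and> (\<forall>x\<in>P. \<forall>y\<in>P. x \<noteq> y \<longrightarrow> s \<le> d x y)"
    using P unfolding \<P>_def by (rule CollectD)
  ultimately show ?thesis by (intro exI[of _ P]) simp
qed

text \<open>A McShane extension for the distance in which the shortcuts cost nothing. By
  \<open>out\<close>, passing through a shortcut saves nothing between points outside its ball;
  hence chains with at most one shortcut suffice, and the values off the balls are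
  preserved.\<close>

lemma (in Metric_space) lipschitz_shortcut_step:
  fixes g :: "'a \<Rightarrow> real" and q :: "'a \<Rightarrow> bool \<Rightarrow> 'a"
  assumes disj: "\<And>p p'. p \<in> P \<Longrightarrow> p' \<in> P \<Longrightarrow> p \<noteq> p' \<Longrightarrow> mball p s \<inter> mball p' s = {}"
    and q: "\<And>p b. p \<in> P \<Longrightarrow> q p b \<in> mball p s"
    and out: "\<And>p x y. p \<in> P \<Longrightarrow> x \<in> M - mball p s \<Longrightarrow> y \<in> M - mball p s \<Longrightarrow>
                d x y \<le> d x (q p True) + d y (q p False)"
    and lip: "\<And>x y. x \<in> M \<Longrightarrow> y \<in> M \<Longrightarrow> g x \<le> g y + d x y"
    and "s > 0"
  shows "\<exists>g'. (\<forall>x\<in>M. \<forall>y\<in>M. g' x \<le> g' y + d x y) \<and>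
    (\<forall>x\<in>M. (\<forall>p\<in>P. x \<notin> mball p s) \<longrightarrow> g' x = g x) \<and>
    (\<forall>p\<in>P. g' (q p True) = g' (q p False)) \<and> (\<forall>x\<in>M. \<bar>g' x - g x\<bar> \<le> 4 * s)"
proof -
  have qM: "q p b \<in> M" if "p \<in> P" for p b using q[OF that] by auto
  have close: "d x y < 2 * s" if "x \<in> mball p s" "y \<in> mball p s" for p x y
    using that triangle''[of x p y] by auto
  have out': "d x y \<le> d x (q p b) + d (q p (\<not> b)) y"
    if "p \<in> P" "x \<in> M" "y \<in> M" "x \<notin> mball p s" "y \<notin> mball p s" for p b x y
    using out[of p x y] out[of p y x] that by (cases b) (auto simp: commute)
  define K where "K p = max (g (q p True)) (g (q p False))" for p
  have gK: "g (q p b) \<le> K p" for p b by (cases b) (auto simp: K_def)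
  define C where "C = {x \<in> M. \<forall>p\<in>P. x \<notin> mball p s}"
  \<comment> \<open>Prescribed values: \<open>g\<close> off the balls, a common value \<open>K p\<close> at both ends of a shortcut. Their
    largest 1-Lipschitz extension for the metric in which chains may use one shortcut is \<open>g'\<close>.\<close>
  define W where "W = {(a, g a) |a. a \<in> C} \<union> {(q p b, K p) |p b. p \<in> P}"
  have WM: "a \<in> M" and Wg: "g a \<le> v" if "(a, v) \<in> W" for a v
    using that qM gK by (auto simp: W_def C_def)
  have Wq: "(q p b, K p) \<in> W" if "p \<in> P" for p b using that by (auto simp: W_def)
  have WC: "(x, g x) \<in> W" if "x \<in> C" for x using that by (auto simp: W_def)
  \<comment> \<open>The start \<open>a\<close> of a chain through a shortcut must lie outside the
    ball of that shortcut, since \<open>out\<close> applies only there. The prescribed points inside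
    the ball are the two endpoints, which share the value \<open>K p\<close> anyway.\<close>
  define T where "T z = {v + d a z |a v. (a, v) \<in> W} \<union>
    {v + d a (q p b) + d (q p (\<not> b)) z |a v p b. (a, v) \<in> W \<and> p \<in> P \<and> a \<notin> mball p s}" for z
  define g' where "g' z = Inf (T z)" for z
  have T_direct: "v + d a z \<in> T z" if "(a, v) \<in> W" for a v z
    using that by (auto simp: T_def)
  have T_via: "v + d a (q p b) + d (q p (\<not> b)) z \<in> T z" if "(a, v) \<in> W" "p \<in> P" "a \<notin> mball p s" for a v p b z
    using that unfolding T_def by blast
  have T_cases: thesis if "t \<in> T z" "\<And>a v. (a, v) \<in> W \<Longrightarrow> t = v + d a z \<Longrightarrow> thesis"
    "\<And>a v p b. (a, v) \<in> W \<Longrightarrow> p \<in> P \<Longrightarrow> a \<notin> mball p s \<Longrightarrow> t = v + d a (q p b) + d (q p (\<not> b)) z \<Longrightarrow> thesis"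
    for t z thesis
    using that unfolding T_def by blast
  \<comment> \<open>Both ends of a shortcut lie in one ball of radius \<open>s\<close>, so a jump
    changes \<open>g\<close> by at most \<open>2 * s\<close>. This makes the infimum finite and is
    also half of the final error bound.\<close>
  have T_lower: "g z - 2 * s \<le> t" if z: "z \<in> M" and t: "t \<in> T z" for z t
    using t
  proof (rule T_cases)
    fix a v assume "(a, v) \<in> W" "t = v + d a z"
    then show ?thesis using lip[of z a] WM[of a v] Wg[of a v] z \<open>s > 0\<close> by (auto simp: commute)
  next
    fix a v p b assume *: "(a, v) \<in> W" "p \<in> P" "t = v + d a (q p b) + d (q p (\<not> b)) z"
    have "g z \<le> g (q p (\<not> b)) + d (q p (\<not> b)) z" using lip[of z "q p (\<not> b)"] z qM[OF *(2)] by (simp add: commute)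
    also have "g (q p (\<not> b)) \<le> g (q p b) + 2 * s"
      using lip[of "q p (\<not> b)" "q p b"] qM[OF *(2)] close[OF q[OF *(2)] q[OF *(2)], of "\<not> b" b] by auto
    also have "g (q p b) \<le> v + d a (q p b)"
      using lip[of "q p b" a] qM[OF *(2)] WM[OF *(1)] Wg[OF *(1)] by (simp add: commute)
    finally show ?thesis using * by simp
  qed
  have bdd: "bdd_below (T z)" if "z \<in> M" for z
    using T_lower[OF that] by (rule bdd_belowI)
  have g'_le: "g' z \<le> t" if "z \<in> M" "t \<in> T z" for z t
    unfolding g'_def using that bdd by (intro cInf_lower)
  have nonempty: "T z \<noteq> {}" if z: "z \<in> M" for z
  proof (cases "z \<in> C")
    case True then show ?thesis using T_direct[OF WC] by blast
  next
    case False
    then obtain p where "p \<in> P" using z unfolding C_def by blast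
    then show ?thesis using T_direct[OF Wq] by blast
  qed
  have g'_ge: "c \<le> g' z" if "z \<in> M" "\<And>t. t \<in> T z \<Longrightarrow> c \<le> t" for z c
    unfolding g'_def using that nonempty by (intro cInf_greatest)
  have g'_lip: "g' x \<le> g' y + d x y" if xy: "x \<in> M" "y \<in> M" for x y
  proof -
    have "g' x - d x y \<le> g' y"
    proof (rule g'_ge[OF xy(2)])
      fix t assume "t \<in> T y"
      then show "g' x - d x y \<le> t"
      proof (rule T_cases)
        fix a v assume *: "(a, v) \<in> W" "t = v + d a y"
        have "g' x \<le> v + d a x" by (rule g'_le[OF xy(1) T_direct[OF *(1)]])
        then show ?thesis using triangle'[of a y x] WM[OF *(1)] xy * by simp
      next
        fix a v p b assume *: "(a, v) \<in> W" "p \<in> P" "a \<notin> mball p s" "t = v + d a (q p b) + d (q p (\<not> b)) y"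
        have "g' x \<le> v + d a (q p b) + d (q p (\<not> b)) x" by (rule g'_le[OF xy(1) T_via[OF *(1-3)]])
        then show ?thesis using triangle'[of "q p (\<not> b)" y x] qM[OF *(2)] xy * by simp
      qed
    qed
    then show ?thesis by simp
  qed
  have g'_q: "g' (q p b) \<le> g' (q p (\<not> b))" if p: "p \<in> P" for p b
  proof (rule g'_ge[OF qM[OF p]])
    have direct: "g' (q p b) \<le> v + d a (q p (\<not> b))" if W: "(a, v) \<in> W" for a v
    proof (cases "a \<in> mball p s")
      case False
      have "g' (q p b) \<le> v + d a (q p (\<not> b)) + d (q p (\<not> \<not> b)) (q p b)"
        by (rule g'_le[OF qM[OF p] T_via[OF W p False]])
      then show ?thesis using qM[OF p] by simp
    next
      case True
      have "a \<notin> C" using True p unfolding C_def by blast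
      then obtain p' b' where p': "p' \<in> P" "a = q p' b'" "v = K p'"
        using W unfolding W_def by blast
      then have "p' = p"
        using disj[OF p, of p'] q[OF p'(1), of b'] True by blast
      then have "v = K p" using p' by simp
      then have "g' (q p b) \<le> v + d (q p b) (q p b)"
        using g'_le[OF qM[OF p] T_direct[OF Wq[OF p]]] by metis
      then show ?thesis using qM[OF p] by (simp add: add_increasing2)
    qed
    fix t assume "t \<in> T (q p (\<not> b))"
    then show "g' (q p b) \<le> t"
    proof (rule T_cases)
      fix a v assume "(a, v) \<in> W" "t = v + d a (q p (\<not> b))"
      then show ?thesis using direct by simp
    next
      fix a v p' c assume *: "(a, v) \<in> W" "p' \<in> P" "a \<notin> mball p' s"
        "t = v + d a (q p' c) + d (q p' (\<not> c)) (q p (\<not> b))"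
      show ?thesis
      proof (cases "p' = p")
        case False
        then have "q p (\<not> b) \<notin> mball p' s" using disj[OF p *(2)] q[OF p, of "\<not> b"] by blast
        then have "d a (q p (\<not> b)) \<le> d a (q p' c) + d (q p' (\<not> c)) (q p (\<not> b))"
          by (intro out' WM[OF *(1)] qM p *)
        then show ?thesis using direct[OF *(1)] * by simp
      next
        case True
        show ?thesis
        proof (cases "c = b")
          case True
          have "g' (q p b) \<le> v + d a (q p b)" by (rule g'_le[OF qM[OF p] T_direct[OF *(1)]])
          then show ?thesis using * True \<open>p' = p\<close> qM[OF p] by simp
        next
          case False
          then have "c = (\<not> b)" by simp
          then show ?thesis using direct[OF *(1)] * \<open>p' = p\<close> by (simp add: add_increasing2)
        qed
      qed
    qed
  qed
  show ?thesis
  proof (intro exI[of _ g'] conjI ballI impI)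
    show "g' x \<le> g' y + d x y" if "x \<in> M" "y \<in> M" for x y using that by (rule g'_lip)
    show "g' (q p True) = g' (q p False)" if "p \<in> P" for p
      using g'_q[OF that, of True] g'_q[OF that, of False] by simp
    show g'_C: "g' x = g x" if x: "x \<in> M" "\<forall>p\<in>P. x \<notin> mball p s" for x
    proof (rule antisym)
      have "g' x \<le> g x + d x x"
        using x by (intro g'_le T_direct WC) (auto simp: C_def)
      then show "g' x \<le> g x" using x by simp
      show "g x \<le> g' x"
      proof (rule g'_ge[OF x(1)])
        have direct: "g x \<le> v + d a x" if "(a, v) \<in> W" for a v
          using lip[of x a] WM[OF that] Wg[OF that] x by (simp add: commute)
        fix t assume "t \<in> T x"
        then show "g x \<le> t"
        proof (rule T_cases)
          fix a v p b assume *: "(a, v) \<in> W" "p \<in> P" "a \<notin> mball p s" "t = v + d a (q p b) + d (q p (\<not> b)) x"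
          then have "d a x \<le> d a (q p b) + d (q p (\<not> b)) x"
            using x WM by (intro out') auto
          then show ?thesis using direct[OF *(1)] * by simp
        qed (use direct in auto)
      qed
    qed
    show "\<bar>g' x - g x\<bar> \<le> 4 * s" if x: "x \<in> M" for x
    proof (cases "x \<in> C")
      case True
      then show ?thesis using g'_C[of x] \<open>s > 0\<close> by (simp add: C_def)
    next
      case False
      then obtain p where p: "p \<in> P" "x \<in> mball p s" using x unfolding C_def by blast
      \<comment> \<open>Going from \<open>x\<close> to the endpoint that realises the maximum and
        back costs at most \<open>2 * s\<close> each way, whence \<open>4 * s\<close>.\<close>
      obtain b where b: "K p = g (q p b)" unfolding K_def max_def by metis
      have "g' x \<le> g (q p b) + d (q p b) x"
        using g'_le[OF x T_direct[OF Wq[OF p(1)]]] b by metis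
      also have "\<dots> \<le> g x + 4 * s"
        using lip[of "q p b" x] close[OF q[OF p(1)] p(2), of b] qM[OF p(1), of b] x by simp
      finally have "g' x \<le> g x + 4 * s" .
      moreover have "g x - 2 * s \<le> g' x" using g'_ge[OF x T_lower[OF x]] by blast
      ultimately show ?thesis using \<open>s > 0\<close> by simp
    qed
  qed
qed

subsection \<open>Scales, nets and shortcuts\<close>

text \<open>\<open>pr r p\<close> is a choice of the pair in the hypothesis, indexed by
  \<open>bool\<close> so that \<open>\<not> b\<close> names the opposite end. \<open>D\<close> is a
  real bound on the radii used, chosen in the end below half the possibly infinite diameter.\<close>

locale shortcut_space = Metric_space M d for M :: "'a set" and d +
  fixes D l :: real and pr :: "real \<Rightarrow> 'a \<Rightarrow> bool \<Rightarrow> 'a"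
  assumes D_pos: "D > 0" and l_pos: "l > 0" and l_less_1: "l < 1"
    and pr_mball: "\<And>p r b. p \<in> M \<Longrightarrow> 0 < r \<Longrightarrow> r \<le> D \<Longrightarrow> pr r p b \<in> mball p r"
    and pr_far: "\<And>p r. p \<in> M \<Longrightarrow> 0 < r \<Longrightarrow> r \<le> D \<Longrightarrow> l * r \<le> d (pr r p True) (pr r p False)"
    and pr_out: "\<And>p r x y. p \<in> M \<Longrightarrow> 0 < r \<Longrightarrow> r \<le> D \<Longrightarrow> x \<in> M - mball p r \<Longrightarrow> y \<in> M - mball p r \<Longrightarrow>
                   d x y \<le> d x (pr r p True) + d y (pr r p False)"
begin

text \<open>The shortcuts of generation \<open>n\<close> join \<open>q n p True\<close> to \<open>q n p False\<close>, both in the ball of radius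
  \<open>s n\<close> about a point \<open>p\<close> of \<open>P n\<close>, and get length at most \<open>w n\<close>. \<open>E n\<close> consists of the endpoints of
  the generations before \<open>n\<close>, which \<open>P n\<close> has to avoid. The ratios \<open>s (Suc n) / s n\<close> tend to \<open>0\<close>, so that
  \<open>w n\<close> can dominate the total effect of all later generations and still be negligible against \<open>s n\<close>.\<close>

primrec s :: "nat \<Rightarrow> real" where
  "s 0 = l * D / 100"
| "s (Suc n) = s n * (l\<^sup>2 / (1000 * (real n + 1)))"

definition maxsep :: "real \<Rightarrow> 'a set \<Rightarrow> 'a set" where
  "maxsep r Y = (SOME P. P \<subseteq> Y \<and> (\<forall>x\<in>P. \<forall>y\<in>P. x \<noteq> y \<longrightarrow> r \<le> d x y) \<and> (\<forall>y\<in>Y. \<exists>p\<in>P. d y p < r))"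

primrec E :: "nat \<Rightarrow> 'a set" where
  "E 0 = {}"
| "E (Suc n) = E n \<union> {pr (s n) p b |p b. p \<in> maxsep (4 * s n) {y \<in> M. \<forall>e\<in>E n. 4 * s n \<le> d y e}}"

definition P :: "nat \<Rightarrow> 'a set" where
  "P n = maxsep (4 * s n) {y \<in> M. \<forall>e\<in>E n. 4 * s n \<le> d y e}"

definition q :: "nat \<Rightarrow> 'a \<Rightarrow> bool \<Rightarrow> 'a" where
  "q n p b = pr (s n) p b"

definition w :: "nat \<Rightarrow> real" where
  "w n = 20 * s (Suc n)"

declare s.simps [simp del]

text \<open>The intended recursion. The definition of \<open>E\<close> has to spell out
  \<open>P\<close> because \<open>P n\<close> in turn depends on \<open>E n\<close>.\<close>

lemma E_Suc: "E (Suc n) = E n \<union> {q n p b |p b. p \<in> P n}"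
  by (simp add: P_def q_def)

lemma s_pos: "s n > 0"
  by (induction n) (use D_pos l_pos in \<open>auto simp: s.simps\<close>)

lemma l2_le: "l\<^sup>2 \<le> l"
  using l_pos l_less_1 by (simp add: power2_eq_square mult_left_le)

lemma s_Suc_le: "s (Suc n) \<le> l\<^sup>2 / 1000 * s n"
proof -
  have "l\<^sup>2 / (1000 * (real n + 1)) \<le> l\<^sup>2 / 1000"
    using l_pos by (intro divide_left_mono) auto
  then have "s n * (l\<^sup>2 / (1000 * (real n + 1))) \<le> s n * (l\<^sup>2 / 1000)"
    using s_pos[of n] by (intro mult_left_mono) auto
  then show ?thesis by (simp only: s.simps mult.commute)
qed

lemma s_Suc_le_l: "s (Suc n) \<le> l / 1000 * s n"
proof -
  have "l\<^sup>2 / 1000 * s n \<le> l / 1000 * s n"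
    using l2_le s_pos[of n] by (intro mult_right_mono) auto
  then show ?thesis using s_Suc_le[of n] by simp
qed

lemma s_Suc_le_1000: "s (Suc n) \<le> s n / 1000"
proof -
  have "l / 1000 * s n \<le> 1 / 1000 * s n"
    using l_less_1 s_pos[of n] by (intro mult_right_mono) auto
  then show ?thesis using s_Suc_le_l[of n] by simp
qed

lemma s_antimono: "m \<le> n \<Longrightarrow> s n \<le> s m"
proof (induction n rule: dec_induct)
  case (step n) then show ?case using s_Suc_le_1000[of n] s_pos[of n] by simp
qed simp

lemma s_le: "s n \<le> l * D / 100"
  using s_antimono[of 0 n] by (simp add: s.simps)

lemma s_le_D: "s n \<le> D / 100"
proof -
  have "l * D / 100 \<le> 1 * D / 100" using l_less_1 D_pos by (intro divide_right_mono mult_right_mono) auto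
  then show ?thesis using s_le[of n] by simp
qed

lemma s_tendsto_0: "s \<longlonglongrightarrow> 0"
proof -
  have le: "s n \<le> s 0 * (1/2) ^ n" for n
  proof (induction n)
    case (Suc n)
    have "s (Suc n) \<le> s n * (1/2)" using s_Suc_le_1000[of n] s_pos[of n] by simp
    also have "\<dots> \<le> s 0 * (1/2) ^ n * (1/2)" using Suc by (intro mult_right_mono) auto
    finally show ?case by (simp only: power_Suc2 mult.assoc)
  qed simp
  have lim: "(\<lambda>n. s 0 * (1/2) ^ n) \<longlonglongrightarrow> 0"
    by (intro tendsto_mult_right_zero LIMSEQ_power_zero) auto
  show ?thesis
    by (rule tendsto_sandwich[OF _ _ tendsto_const lim])
       (use le s_pos in \<open>auto intro!: always_eventually less_imp_le\<close>)
qed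

lemma w_over_s_tendsto_0: "(\<lambda>n. w n / s n) \<longlonglongrightarrow> 0"
proof -
  have "w n / s n = l\<^sup>2 / 50 * inverse (real (Suc n))" for n
  proof -
    have "w n / s n = 20 * (l\<^sup>2 / (1000 * (real n + 1)))"
      using s_pos[of n] by (simp add: w_def s.simps(2))
    also have "\<dots> = l\<^sup>2 / 50 * inverse (real (Suc n))" by (simp add: divide_simps)
    finally show ?thesis .
  qed
  moreover have "(\<lambda>n. l\<^sup>2 / 50 * inverse (real (Suc n))) \<longlonglongrightarrow> 0"
    by (intro tendsto_mult_right_zero LIMSEQ_inverse_real_of_nat)
  ultimately show ?thesis by presburger
qed

lemma w_pos: "w n > 0"
  using s_pos by (simp add: w_def)

lemma w_antimono: "m \<le> n \<Longrightarrow> w n \<le> w m"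
  unfolding w_def using s_antimono[of "Suc m" "Suc n"] by simp

lemma P_spec:
  "P n \<subseteq> {y \<in> M. \<forall>e\<in>E n. 4 * s n \<le> d y e} \<and> (\<forall>x\<in>P n. \<forall>y\<in>P n. x \<noteq> y \<longrightarrow> 4 * s n \<le> d x y) \<and>
   (\<forall>y\<in>{y \<in> M. \<forall>e\<in>E n. 4 * s n \<le> d y e}. \<exists>p\<in>P n. d y p < 4 * s n)"
  unfolding P_def maxsep_def
  by (rule someI_ex, rule maximal_separated_subset) (use s_pos in auto)

lemma P_M: "p \<in> P n \<Longrightarrow> p \<in> M"
  and P_E: "p \<in> P n \<Longrightarrow> e \<in> E n \<Longrightarrow> 4 * s n \<le> d p e"
  and P_sep: "p \<in> P n \<Longrightarrow> p' \<in> P n \<Longrightarrow> p \<noteq> p' \<Longrightarrow> 4 * s n \<le> d p p'"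
  and P_max: "y \<in> M \<Longrightarrow> (\<And>e. e \<in> E n \<Longrightarrow> 4 * s n \<le> d y e) \<Longrightarrow> \<exists>p\<in>P n. d y p < 4 * s n"
  using P_spec[of n] by blast+

lemma s_le_D1: "s n \<le> D"
  using s_le_D[of n] D_pos by simp

lemma q_mball: "p \<in> P n \<Longrightarrow> q n p b \<in> mball p (s n)"
  unfolding q_def by (intro pr_mball P_M s_pos s_le_D1)

lemma q_M: "p \<in> P n \<Longrightarrow> q n p b \<in> M"
  using q_mball by fastforce

lemma q_dist: "p \<in> P n \<Longrightarrow> d p (q n p b) < s n"
  using q_mball by fastforce

lemma q_far: "p \<in> P n \<Longrightarrow> l * s n \<le> d (q n p b) (q n p (\<not> b))"
  using pr_far[OF P_M s_pos s_le_D1, of p n n] by (cases b) (auto simp: q_def commute)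

lemma E_M: "E n \<subseteq> M"
proof (induction n)
  case (Suc n) then show ?case unfolding E_Suc using q_M by blast
qed simp

lemma q_in_E: "p \<in> P m \<Longrightarrow> m < n \<Longrightarrow> q m p b \<in> E n"
proof (induction n)
  case (Suc n) then show ?case unfolding E_Suc by (cases "m = n") auto
qed simp

lemma E_cases:
  assumes "e \<in> E n" obtains m p b where "m < n" "p \<in> P m" "e = q m p b"
proof -
  have "\<exists>m<n. \<exists>p\<in>P m. \<exists>b. e = q m p b"
    using assms
  proof (induction n)
    case (Suc n) then show ?case unfolding E_Suc using less_Suc_eq by auto
  qed simp
  then show thesis using that by blast
qed

section \<open>Separation of the endpoints and density of the nets\<close>

lemma q_E_far: "p \<in> P n \<Longrightarrow> e \<in> E n \<Longrightarrow> 3 * s n \<le> d (q n p b) e"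
  using P_E[of p n e] q_dist[of p n b] triangle[of p "q n p b" e] P_M[of p n] q_M[of p n b] E_M[of n]
  by (simp add: subset_iff)

lemma q_q_far:
  assumes "p \<in> P n" "p' \<in> P n" "p \<noteq> p'" shows "2 * s n \<le> d (q n p b) (q n p' b')"
proof -
  note M = P_M[OF assms(1)] P_M[OF assms(2)] q_M[OF assms(1), of b] q_M[OF assms(2), of b']
  show ?thesis
    using P_sep[OF assms] q_dist[OF assms(1), of b] q_dist[OF assms(2), of b']
      triangle[of p "q n p b" p'] triangle'[of "q n p b" "q n p' b'" p'] M by linarith
qed

lemma q_inj:
  assumes "p \<in> P m" "p' \<in> P m'" "q m p b = q m' p' b'"
  shows "m = m' \<and> p = p'"
proof -
  have less: False if "m < m'" "p \<in> P m" "p' \<in> P m'" "q m p b = q m' p' b'" for m m' p p' b b'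
    using q_E_far[OF that(3) q_in_E[OF that(2,1)], of b' b] that s_pos[of m'] q_M[OF that(3)] by simp
  have "m = m'"
    using less[of m m' p p' b b'] less[of m' m p' p b' b] assms by (metis nat_neq_iff)
  moreover have "p = p'"
  proof (rule ccontr)
    assume "p \<noteq> p'"
    then show False
      using q_q_far[of p m p' b b'] assms \<open>m = m'\<close> s_pos[of m] q_M[of p' m' b'] by simp
  qed
  ultimately show ?thesis ..
qed

text \<open>A new endpoint is \<open>3 * s n\<close> away from the old ones and
  \<open>2 * s n\<close> from those at other net points; the worst case is the two ends of one
  shortcut, with \<open>l * s n\<close>.\<close>

lemma E_Suc_sep:
  assumes IH: "\<And>e e'. e \<in> E n \<Longrightarrow> e' \<in> E n \<Longrightarrow> e \<noteq> e' \<Longrightarrow> l * s n \<le> d e e'"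
    and e: "e \<in> E (Suc n)" "e' \<in> E (Suc n)" "e \<noteq> e'"
  shows "l * s n \<le> d e e'"
proof -
  have ls: "l * s n \<le> s n" using l_less_1 s_pos[of n] by simp
  have mixed: "l * s n \<le> d (q n p b) e" if "p \<in> P n" "e \<in> E n" for p b e
    using q_E_far[OF that, of b] ls s_pos[of n] by linarith
  have new: "l * s n \<le> d (q n p b) (q n p' b')" if "p \<in> P n" "p' \<in> P n" "q n p b \<noteq> q n p' b'" for p p' b b'
  proof (cases "p = p'")
    case True
    then have "b' = (\<not> b)" using that(3) by (cases b; cases b') auto
    then show ?thesis using q_far[OF that(1)] True by simp
  next
    case False
    then show ?thesis using q_q_far[OF that(1,2) False, of b b'] ls s_pos[of n] by linarith
  qed
  show ?thesis
    using e unfolding E_Suc using IH mixed new by (auto simp: commute)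
qed

lemma E_sep: "e \<in> E (Suc n) \<Longrightarrow> e' \<in> E (Suc n) \<Longrightarrow> e \<noteq> e' \<Longrightarrow> l * s n \<le> d e e'"
proof (induction n arbitrary: e e')
  case 0 show ?case by (rule E_Suc_sep) (use 0 in auto)
next
  case (Suc n)
  have "l * s (Suc n) \<le> l * s n" using s_antimono[of n "Suc n"] l_pos by (intro mult_left_mono) auto
  then show ?case using Suc.IH by (intro E_Suc_sep[OF _ Suc.prems]) (meson order_trans)
qed

text \<open>At most one endpoint of an earlier generation is close to \<open>x\<close>, whereas the pair given at \<open>x\<close>
  is spread out, so one of its two points lies in the region in which \<open>P n\<close> is maximal.\<close>

lemma P_near:
  assumes "x \<in> M" obtains p where "p \<in> P n" "d x p < 12 * s n / l"
proof -
  \<comment> \<open>With this radius the pair at \<open>x\<close> is \<open>8 * s n\<close> apart,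
    so its points cannot both be within \<open>4 * s n\<close> of the same endpoint.\<close>
  define r where "r = 8 * s n / l"
  have r: "0 < r" "r \<le> D"
    using s_pos[of n] l_pos s_le[of n] D_pos by (auto simp: r_def field_simps)
  have lr: "l * r = 8 * s n" using l_pos by (simp add: r_def)
  have "\<exists>b. \<forall>e\<in>E n. 4 * s n \<le> d (pr r x b) e"
  proof (rule ccontr)
    assume "\<not> ?thesis"
    then obtain e where e: "\<And>b. e b \<in> E n" "\<And>b. d (pr r x b) (e b) < 4 * s n"
      by (metis not_le)
    note M = pr_mball[OF assms r, of True] pr_mball[OF assms r, of False] e(1)[of True, THEN E_M[THEN subsetD]] e(1)[of False, THEN E_M[THEN subsetD]]
    have far: "8 * s n \<le> d (pr r x True) (pr r x False)" using pr_far[OF assms r] lr by simp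
    show False
    proof (cases "e True = e False")
      case True
      then show False
        using far e(2)[of True] e(2)[of False] triangle'[of "pr r x True" "e True" "pr r x False"] M by auto
    next
      case False
      obtain k where k: "n = Suc k" using e(1)[of True] by (cases n) auto
      have "l * s k \<le> d (e True) (e False)"
        using E_sep e(1) False unfolding k by blast
      moreover have "d (e True) (e False) < 8 * s n + 2 * r"
        using e(2)[of True] e(2)[of False] M
          triangle''[of "e True" "pr r x True" "e False"] triangle[of "pr r x True" "pr r x False" "e False"]
          triangle''[of "pr r x True" x "pr r x False"] by simp
      moreover have "8 * s n + 2 * r \<le> 24 * s n / l"
        using s_pos[of n] l_pos l_less_1 by (simp add: r_def field_simps)
      \<comment> \<open>Here the square of \<open>l\<close> in the ratio of the scales is used: one
        factor comes from the radius \<open>r\<close>, the other from the separation of old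
        endpoints.\<close>
      moreover have "24 * s n / l \<le> l * s k"
        using s_Suc_le[of k] l_pos s_pos[of k] s_pos[of "Suc k"] unfolding k by (simp add: field_simps power2_eq_square)
      ultimately show False by linarith
    qed
  qed
  then obtain b where b: "\<And>e. e \<in> E n \<Longrightarrow> 4 * s n \<le> d (pr r x b) e" by blast
  have M: "pr r x b \<in> M" "d x (pr r x b) < r" using pr_mball[OF assms r, of b] by auto
  obtain p where p: "p \<in> P n" "d (pr r x b) p < 4 * s n"
    using P_max[OF M(1) b] by blast
  have "d x p < r + 4 * s n"
    using M p triangle[OF assms M(1) P_M[OF p(1)]] by simp
  also have "\<dots> \<le> 12 * s n / l"
    using s_pos[of n] l_pos l_less_1 by (simp add: r_def field_simps)
  finally show thesis using that p(1) by blast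
qed

subsection \<open>The shortened distance\<close>

text \<open>Tolerating a variation \<open>w m\<close> across a shortcut, instead of asking for
  equality, admits every 1-Lipschitz function with values between \<open>0\<close> and
  \<open>w n\<close> up to generation \<open>n\<close>. This is what makes the new distance
  positive.\<close>

definition admissible_upto :: "nat \<Rightarrow> ('a \<Rightarrow> real) \<Rightarrow> bool" where
  "admissible_upto N f \<longleftrightarrow> (\<forall>x\<in>M. \<forall>y\<in>M. f x \<le> f y + d x y) \<and>
     (\<forall>m<N. \<forall>p\<in>P m. \<bar>f (q m p True) - f (q m p False)\<bar> \<le> w m)"

definition admissible :: "('a \<Rightarrow> real) \<Rightarrow> bool" where
  "admissible f \<longleftrightarrow> (\<forall>N. admissible_upto N f)"

lemma admissible_upto_lip: "admissible_upto N f \<Longrightarrow> x \<in> M \<Longrightarrow> y \<in> M \<Longrightarrow> f x \<le> f y + d x y"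
  by (simp add: admissible_upto_def)

lemma admissible_upto_q: "admissible_upto N f \<Longrightarrow> m < N \<Longrightarrow> p \<in> P m \<Longrightarrow> \<bar>f (q m p True) - f (q m p False)\<bar> \<le> w m"
  by (simp add: admissible_upto_def)

text \<open>The function changes only in the balls of generation \<open>N\<close>. These contain no
  older endpoint, because \<open>P N\<close> keeps a distance of \<open>4 * s N\<close> from
  \<open>E N\<close>, so the earlier constraints survive.\<close>

lemma admissible_upto_Suc:
  assumes "admissible_upto N f"
  shows "\<exists>g. admissible_upto (Suc N) g \<and> (\<forall>x\<in>M. \<bar>g x - f x\<bar> \<le> 4 * s N)"
proof -
  have disj: "mball p (s N) \<inter> mball p' (s N) = {}" if "p \<in> P N" "p' \<in> P N" "p \<noteq> p'" for p p'
    using disjoint_mball[of "s N" "s N" p p'] P_sep[OF that] s_pos[of N] by (simp add: disjnt_def)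
  have out: "d x y \<le> d x (q N p True) + d y (q N p False)"
    if "p \<in> P N" "x \<in> M - mball p (s N)" "y \<in> M - mball p (s N)" for p x y
    unfolding q_def using that by (intro pr_out P_M s_pos s_le_D1)
  have "\<exists>g. (\<forall>x\<in>M. \<forall>y\<in>M. g x \<le> g y + d x y) \<and>
    (\<forall>x\<in>M. (\<forall>p\<in>P N. x \<notin> mball p (s N)) \<longrightarrow> g x = f x) \<and>
    (\<forall>p\<in>P N. g (q N p True) = g (q N p False)) \<and> (\<forall>x\<in>M. \<bar>g x - f x\<bar> \<le> 4 * s N)"
    by (rule lipschitz_shortcut_step) (assumption | rule disj q_mball out admissible_upto_lip[OF assms] s_pos)+
  then obtain g where lip: "\<forall>x\<in>M. \<forall>y\<in>M. g x \<le> g y + d x y"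
    and same: "\<forall>x\<in>M. (\<forall>p\<in>P N. x \<notin> mball p (s N)) \<longrightarrow> g x = f x"
    and eq: "\<forall>p\<in>P N. g (q N p True) = g (q N p False)"
    and close: "\<forall>x\<in>M. \<bar>g x - f x\<bar> \<le> 4 * s N"
    by (elim exE conjE)
  have E_same: "g e = f e" if "e \<in> E N" for e
  proof (rule same[rule_format])
    show "e \<in> M" using that E_M by blast
    show "e \<notin> mball p (s N)" if "p \<in> P N" for p
      using P_E[OF that \<open>e \<in> E N\<close>] s_pos[of N] by simp
  qed
  have "\<bar>g (q m p True) - g (q m p False)\<bar> \<le> w m" if m: "m < Suc N" "p \<in> P m" for m p
  proof (cases "m = N")
    case True
    then show ?thesis using eq m w_pos[of N] by simp
  next
    case False
    then have "m < N" using m by simp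
    then show ?thesis
      using admissible_upto_q[OF assms _ m(2)] E_same[OF q_in_E[OF m(2)]] by simp
  qed
  then have "admissible_upto (Suc N) g" using lip unfolding admissible_upto_def by blast
  then show ?thesis using close by blast
qed

lemma admissible_upto_mono: "admissible_upto N f \<Longrightarrow> m \<le> N \<Longrightarrow> admissible_upto m f"
  unfolding admissible_upto_def by auto

text \<open>All conditions are weak inequalities between values at two points, hence closed under
  pointwise limits.\<close>

lemma admissible_upto_cong_limit:
  assumes "\<And>k. admissible_upto N (G k)" "\<And>x. x \<in> M \<Longrightarrow> (\<lambda>k. G k x) \<longlonglongrightarrow> f x"
  shows "admissible_upto N f"
  unfolding admissible_upto_def
proof (intro conjI ballI allI impI)
  fix x y assume "x \<in> M" "y \<in> M"
  then show "f x \<le> f y + d x y"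
    using admissible_upto_lip[OF assms(1)] by (intro LIMSEQ_le[OF assms(2) tendsto_add[OF assms(2) tendsto_const]]) auto
next
  fix m p assume "m < N" "p \<in> P m"
  then show "\<bar>f (q m p True) - f (q m p False)\<bar> \<le> w m"
    using admissible_upto_q[OF assms(1)] q_M
    by (intro LIMSEQ_le_const2[OF tendsto_rabs[OF tendsto_diff[OF assms(2) assms(2)]]]) auto
qed

text \<open>Apply the one-generation step to \<open>N\<close>, \<open>N + 1\<close>, and so on, and
  pass to the limit; the errors \<open>4 * s (N + k)\<close> decrease so fast that they sum to at
  most \<open>8 * s N\<close>.\<close>

lemma admissible_approx:
  assumes "admissible_upto N f"
  shows "\<exists>g. admissible g \<and> (\<forall>x\<in>M. \<bar>g x - f x\<bar> \<le> 8 * s N)"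
proof -
  have "\<exists>G. \<forall>k. (admissible_upto (N + k) (G k) \<and> (k = 0 \<longrightarrow> G k = f)) \<and> (\<forall>x\<in>M. \<bar>G (Suc k) x - G k x\<bar> \<le> 4 * s (N + k))"
  proof (rule dependent_nat_choice)
    show "\<exists>x. admissible_upto (N + 0) x \<and> (0 = (0::nat) \<longrightarrow> x = f)" using assms by simp
  next
    fix x k assume "admissible_upto (N + k) x \<and> (k = 0 \<longrightarrow> x = f)"
    then show "\<exists>y. (admissible_upto (N + Suc k) y \<and> (Suc k = 0 \<longrightarrow> y = f)) \<and> (\<forall>z\<in>M. \<bar>y z - x z\<bar> \<le> 4 * s (N + k))"
      using admissible_upto_Suc[of "N + k" x] by simp
  qed
  then obtain G where G: "\<And>k. admissible_upto (N + k) (G k)" "G 0 = f"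
    and step: "\<And>k x. x \<in> M \<Longrightarrow> \<bar>G (Suc k) x - G k x\<bar> \<le> 4 * s (N + k)"
    by blast
  have s_half: "8 * s (N + Suc k) \<le> 4 * s (N + k)" for k
    using s_Suc_le_1000[of "N + k"] s_pos[of "N + k"] by simp
  \<comment> \<open>The subtracted term leaves room for the next error and lets the induction
    close.\<close>
  have near: "\<bar>G k x - f x\<bar> \<le> 8 * s N - 8 * s (N + k)" if "x \<in> M" for k x
  proof (induction k)
    case (Suc k)
    then show ?case using step[OF that, of k] s_half[of k] by linarith
  qed (simp add: G)
  have near': "\<bar>G k x - f x\<bar> \<le> 8 * s N" if "x \<in> M" for k x
    using near[OF that, of k] s_pos[of "N + k"] by linarith
  have s_lim: "(\<lambda>k. 8 * s (N + k)) \<longlonglongrightarrow> 0"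
    using LIMSEQ_ignore_initial_segment[OF s_tendsto_0, of N] by (intro tendsto_mult_right_zero) (simp add: add.commute)
  have conv: "convergent (\<lambda>k. G k x)" if "x \<in> M" for x
  proof -
    \<comment> \<open>Adding a bound for the remaining errors turns convergence into monotone
      convergence.\<close>
    have "decseq (\<lambda>k. G k x + 8 * s (N + k))"
    proof (rule decseq_SucI)
      show "G (Suc k) x + 8 * s (N + Suc k) \<le> G k x + 8 * s (N + k)" for k
        using step[OF that, of k] s_half[of k] by linarith
    qed
    moreover have "f x - 8 * s N \<le> G k x + 8 * s (N + k)" for k
      using near'[OF that, of k] s_pos[of "N + k"] by linarith
    ultimately obtain L where "(\<lambda>k. G k x + 8 * s (N + k)) \<longlonglongrightarrow> L"
      using decseq_convergent by blast
    then have "(\<lambda>k. (G k x + 8 * s (N + k)) - 8 * s (N + k)) \<longlonglongrightarrow> L - 0"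
      by (intro tendsto_diff s_lim)
    then show ?thesis by (auto simp: convergent_def)
  qed
  define g where "g x = lim (\<lambda>k. G k x)" for x
  have lim: "(\<lambda>k. G k x) \<longlonglongrightarrow> g x" if "x \<in> M" for x
    using conv[OF that] by (simp add: g_def convergent_LIMSEQ_iff)
  have "admissible g"
    unfolding admissible_def
  proof
    fix n
    show "admissible_upto n g"
    proof (rule admissible_upto_cong_limit)
      \<comment> \<open>The shift by \<open>n\<close> drops the initial functions, which need not
        yet respect the generations before \<open>n\<close>.\<close>
      show "admissible_upto n (G (k + n))" for k using G(1)[of "k + n"] by (rule admissible_upto_mono) simp
      show "(\<lambda>k. G (k + n) x) \<longlonglongrightarrow> g x" if "x \<in> M" for x
        using lim[OF that] by (rule LIMSEQ_ignore_initial_segment)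
    qed
  qed
  moreover have "\<bar>g x - f x\<bar> \<le> 8 * s N" if "x \<in> M" for x
    by (rule LIMSEQ_le_const2[OF tendsto_rabs[OF tendsto_diff[OF lim[OF that] tendsto_const]]])
       (use near'[OF that] in auto)
  ultimately show ?thesis by blast
qed

text \<open>The truncation restricts the radii in the Ahlfors condition to small ones, for which all
  \<open>d\<close>-balls that occur are within the range of the hypotheses.\<close>

definition shortcut_dist :: "'a \<Rightarrow> 'a \<Rightarrow> real" where
  "shortcut_dist x y = (if x \<in> M \<and> y \<in> M then min (l * s 0 / 8) (SUP f\<in>Collect admissible. \<bar>f x - f y\<bar>) else 0)"

lemma admissible_lip:
  assumes "admissible f" "x \<in> M" "y \<in> M" shows "\<bar>f x - f y\<bar> \<le> d x y"
  using admissible_upto_lip[of 0 f x y] admissible_upto_lip[of 0 f y x] assms by (auto simp: admissible_def commute abs_le_iff)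

lemma admissible_0: "admissible (\<lambda>x. 0)"
  using w_pos by (auto simp: admissible_def admissible_upto_def less_imp_le)

lemma SUP_admissible_le: 
  assumes "\<And>f. admissible f \<Longrightarrow> \<bar>f x - f y\<bar> \<le> c"
  shows "(SUP f\<in>Collect admissible. \<bar>f x - f y\<bar>) \<le> c"
  using assms admissible_0 by (intro cSUP_least) auto

lemma SUP_admissible_ge:
  assumes "admissible f" "x \<in> M" "y \<in> M" 
  shows "\<bar>f x - f y\<bar> \<le> (SUP f\<in>Collect admissible. \<bar>f x - f y\<bar>)"
proof (rule cSUP_upper)
  show "bdd_above ((\<lambda>f. \<bar>f x - f y\<bar>) ` Collect admissible)"
    using admissible_lip[OF _ assms(2,3)] by (intro bdd_aboveI[of _ "d x y"]) auto
qed (use assms in simp)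

lemma shortcut_dist_ge: "admissible f \<Longrightarrow> x \<in> M \<Longrightarrow> y \<in> M \<Longrightarrow> min (l * s 0 / 8) \<bar>f x - f y\<bar> \<le> shortcut_dist x y"
  using SUP_admissible_ge[of f x y] by (auto simp: shortcut_dist_def min_def)

lemma shortcut_dist_le: "x \<in> M \<Longrightarrow> y \<in> M \<Longrightarrow> shortcut_dist x y \<le> d x y"
  using SUP_admissible_le[of x y "d x y"] admissible_lip[of _ x y] by (auto simp: shortcut_dist_def intro: min.coboundedI2)

lemma shortcut_dist_le_max: "shortcut_dist x y \<le> l * s 0 / 8"
  using l_pos s_pos[of 0] by (auto simp: shortcut_dist_def)

lemma shortcut_dist_q: "p \<in> P m \<Longrightarrow> shortcut_dist (q m p True) (q m p False) \<le> w m"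
  using SUP_admissible_le[of "q m p True" "q m p False" "w m"] admissible_upto_q[of "Suc m" _ m p] q_M[of p m]
  by (auto simp: shortcut_dist_def admissible_def intro!: min.coboundedI2)

text \<open>The distance to a finite set, cut off at \<open>R\<close>: the test functions for lower
  bounds of \<open>shortcut_dist\<close>.\<close>

lemma tent_lip:
  assumes "A \<subseteq> M" "finite A" "A \<noteq> {}" "x \<in> M" "y \<in> M"
  shows "min R (MIN a\<in>A. d a x) \<le> min R (MIN a\<in>A. d a y) + d x y"
proof -
  have "(MIN a\<in>A. d a y) \<in> (\<lambda>a. d a y) ` A" using assms by (intro Min_in) auto
  then obtain a where a: "a \<in> A" "(MIN a\<in>A. d a y) = d a y" by blast
  have "(MIN a\<in>A. d a x) \<le> d a x" using a assms by (intro Min_le) auto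
  also have "\<dots> \<le> d a y + d x y" using triangle'[of a y x] a assms by auto
  finally show ?thesis
    using a nonneg[of x y] unfolding min_def by (simp split: if_splits del: nonneg)
qed

text \<open>A tent at \<open>x\<close> of height \<open>w n\<close> less than \<open>d x y\<close>
  meets all constraints up to generation \<open>n\<close>. Making it admissible costs
  \<open>8 * s (Suc n)\<close> at each of the two points, and the factor \<open>20\<close> in
  \<open>w n\<close> exceeds the total of \<open>16\<close>.\<close>

lemma shortcut_dist_pos:
  assumes "x \<in> M" "y \<in> M" "x \<noteq> y" shows "shortcut_dist x y > 0"
proof -
  have dpos: "d x y > 0" using assms by simp
  have "(\<lambda>n. 20 * s (Suc n)) \<longlonglongrightarrow> 0"
    using s_tendsto_0 by (intro tendsto_mult_right_zero) (rule LIMSEQ_Suc)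
  then have "eventually (\<lambda>n. w n < d x y) sequentially"
    unfolding w_def using dpos by (rule order_tendstoD)
  then obtain n where n: "w n < d x y" by (auto simp: eventually_sequentially)
  define f where "f z = min (w n) (MIN a\<in>{x}. d a z)" for z
  have f01: "0 \<le> f z" "f z \<le> w n" for z using w_pos[of n] by (auto simp: f_def)
  have "\<bar>f (q m p True) - f (q m p False)\<bar> \<le> w m" if "m < Suc n" "p \<in> P m" for m p
    using f01[of "q m p True"] f01[of "q m p False"] w_antimono[of m n] that(1) by linarith
  moreover have "f u \<le> f v + d u v" if "u \<in> M" "v \<in> M" for u v
    unfolding f_def by (rule tent_lip) (use that assms in auto)
  ultimately have "admissible_upto (Suc n) f" by (simp add: admissible_upto_def)
  then obtain g where g: "admissible g" "\<And>x. x \<in> M \<Longrightarrow> \<bar>g x - f x\<bar> \<le> 8 * s (Suc n)"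
    using admissible_approx by blast
  have "f x = 0" "f y = w n" using n w_pos[of n] assms by (auto simp: f_def)
  then have "\<bar>g x - g y\<bar> > 0" using g(2)[of x] g(2)[of y] assms s_pos[of "Suc n"] by (simp add: w_def)
  moreover have "l * s 0 / 8 > 0" using l_pos s_pos[of 0] by simp
  ultimately show ?thesis using shortcut_dist_ge[OF g(1) assms(1,2)] by (simp add: min_def split: if_splits)
qed

lemma Metric_space_shortcut_dist: "Metric_space M shortcut_dist"
proof
  show "0 \<le> shortcut_dist x y" for x y
  proof (cases "x \<in> M \<and> y \<in> M")
    case True
    then show ?thesis using shortcut_dist_ge[OF admissible_0, of x y] l_pos s_pos[of 0] by simp
  qed (auto simp: shortcut_dist_def)
  show "shortcut_dist x y = shortcut_dist y x" for x y by (auto simp: shortcut_dist_def abs_minus_commute)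
  show "shortcut_dist x y = 0 \<longleftrightarrow> x = y" if "x \<in> M" "y \<in> M" for x y
  proof
    show "x = y" if "shortcut_dist x y = 0" using that shortcut_dist_pos[OF \<open>x \<in> M\<close> \<open>y \<in> M\<close>] by force
    show "shortcut_dist x y = 0" if "x = y"
    proof -
      have "shortcut_dist x y \<ge> 0" using shortcut_dist_ge[OF admissible_0, of x y] l_pos s_pos[of 0] \<open>x \<in> M\<close> \<open>y \<in> M\<close> by simp
      then show ?thesis using shortcut_dist_le[of x x] that \<open>x \<in> M\<close> by simp
    qed
  qed
  show "shortcut_dist x z \<le> shortcut_dist x y + shortcut_dist y z" if M: "x \<in> M" "y \<in> M" "z \<in> M" for x y z
  proof -
    let ?S = "\<lambda>x y. (SUP f\<in>Collect admissible. \<bar>f x - f y\<bar>)"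
    have "?S x z \<le> ?S x y + ?S y z"
    proof (rule SUP_admissible_le)
      fix f assume "admissible f"
      then show "\<bar>f x - f z\<bar> \<le> ?S x y + ?S y z"
        using SUP_admissible_ge[of f x y] SUP_admissible_ge[of f y z] M by linarith
    qed
    moreover have "?S u v \<ge> 0" if "u \<in> M" "v \<in> M" for u v
      using SUP_admissible_ge[OF admissible_0 that] by simp
    moreover have "l * s 0 / 8 > 0" using l_pos s_pos[of 0] by simp
    moreover have "min c t \<le> min c u + min c v" if "t \<le> u + v" "u \<ge> 0" "v \<ge> 0" "c > 0" for c t u v :: real
      using that by (auto simp: min_def)
    ultimately show ?thesis using M by (simp add: shortcut_dist_def)
  qed
qed

section \<open>Balls of the shortened distance\<close>

lemma shortcut_dist_lower:
  assumes A: "A \<subseteq> M" "finite A" "A \<noteq> {}"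
    and const: "\<And>m p. m \<le> n \<Longrightarrow> p \<in> P m \<Longrightarrow>
       min R (MIN a\<in>A. d a (q m p True)) = min R (MIN a\<in>A. d a (q m p False))"
    and xy: "x \<in> M" "y \<in> M"
  shows "min (l * s 0 / 8) (min R (MIN a\<in>A. d a y) - min R (MIN a\<in>A. d a x) - 16 * s (Suc n)) \<le> shortcut_dist x y"
proof -
  define f where "f z = min R (MIN a\<in>A. d a z)" for z
  have "f u \<le> f v + d u v" if "u \<in> M" "v \<in> M" for u v
    unfolding f_def by (rule tent_lip) (use that A in auto)
  moreover have "f (q m p True) = f (q m p False)" if "m < Suc n" "p \<in> P m" for m p
    unfolding f_def using that by (intro const) auto
  ultimately have "admissible_upto (Suc n) f" using w_pos by (simp add: admissible_upto_def less_imp_le)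
  then obtain g where g: "admissible g" "\<And>x. x \<in> M \<Longrightarrow> \<bar>g x - f x\<bar> \<le> 8 * s (Suc n)"
    using admissible_approx by blast
  have "f y - f x - 16 * s (Suc n) \<le> \<bar>g x - g y\<bar>"
    using g(2)[OF xy(1)] g(2)[OF xy(2)] by linarith
  then show ?thesis
    using shortcut_dist_ge[OF g(1) xy] unfolding f_def by (smt (verit) min_def)
qed

text \<open>Pick \<open>n\<close> with \<open>l * s (Suc n) / 4 \<le> r < l * s n / 4\<close>. If no
  endpoint up to generation \<open>n\<close> is within \<open>R\<close> of \<open>x\<close>, a tent
  of height \<open>R\<close> at \<open>x\<close> is constant on all of them. Otherwise use height
  \<open>2 * R\<close> and both ends of the shortcut of such an endpoint as centres: the tent is
  \<open>0\<close> there and, since \<open>2 * R \<le> l * s n\<close>, equals \<open>2 * R\<close>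
  at every other endpoint.\<close>

lemma shortcut_dist_ball_cover:
  assumes x: "x \<in> M" and r: "0 < r" "r \<le> l * s 0 / 8"
  obtains u v where "u \<in> M" "v \<in> M"
    "Metric_space.mball M shortcut_dist x r \<subseteq> mball u (130 * r / l) \<union> mball v (130 * r / l)"
proof -
  interpret S: Metric_space M shortcut_dist by (rule Metric_space_shortcut_dist)
  have "\<exists>n. l * s n / 4 \<le> r"
  proof -
    have "(\<lambda>n. l / 4 * s n) \<longlonglongrightarrow> 0"
      by (intro tendsto_mult_right_zero s_tendsto_0)
    then have "eventually (\<lambda>n. l / 4 * s n < r) sequentially"
      using r(1) by (rule order_tendstoD)
    then show ?thesis by (auto simp: eventually_sequentially intro: less_imp_le)
  qed
  then obtain k where k: "l * s k / 4 \<le> r" "\<And>j. j < k \<Longrightarrow> r < l * s j / 4"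
    using exists_least_iff[of "\<lambda>n. l * s n / 4 \<le> r"] by (auto simp: not_le)
  have "k \<noteq> 0"
  proof
    assume "k = 0"
    then show False using k(1) r(2) mult_pos_pos[OF l_pos s_pos[of 0]] by simp
  qed
  then obtain n where kn: "k = Suc n" by (cases k) auto
  have lo: "l * s (Suc n) / 4 \<le> r" and hi: "r < l * s n / 4" using k kn by auto
  \<comment> \<open>The tent has to rise by \<open>r\<close> plus the loss in
    \<open>shortcut_dist_lower\<close>. As \<open>s (Suc n) \<le> 4 * r / l\<close>, this gives
    \<open>2 * R \<le> 130 * r / l\<close>.\<close>
  define R where "R = r + 16 * s (Suc n)"
  have R0: "R > 0" using r s_pos[of "Suc n"] by (simp add: R_def)
  define t where "t = r / l"
  have "16 * s (Suc n) \<le> 64 * t" using lo l_pos by (simp add: t_def field_simps)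
  moreover have "r \<le> t" using l_pos l_less_1 r by (simp add: t_def field_simps)
  ultimately have "2 * R \<le> 130 * t" unfolding R_def by simp
  then have R_le: "2 * R \<le> 130 * r / l" by (simp add: t_def)
  have R_le': "2 * R \<le> l * s n"
    using hi s_Suc_le_l[of n] mult_pos_pos[OF l_pos s_pos[of n]] by (simp add: R_def)
  \<comment> \<open>Outside the balls the tent has its full height \<open>R'\<close>, hence exceeds
    its value at \<open>x\<close> by at least \<open>R\<close>, which forces
    \<open>shortcut_dist x y \<ge> r\<close>.\<close>
  have sub: "y \<in> (\<Union>a\<in>A. mball a (130 * r / l))"
    if A: "A \<subseteq> M" "finite A" "A \<noteq> {}" and R': "R' \<le> 2 * R"
      and const: "\<And>m p. m \<le> n \<Longrightarrow> p \<in> P m \<Longrightarrow>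
       min R' (MIN a\<in>A. d a (q m p True)) = min R' (MIN a\<in>A. d a (q m p False))"
      and x_near: "min R' (MIN a\<in>A. d a x) \<le> R' - R" and y: "y \<in> S.mball x r" for A R' y
  proof (rule ccontr)
    assume *: "\<not> ?thesis"
    have yM: "y \<in> M" "shortcut_dist x y < r" using y by auto
    have "R' \<le> d a y" if "a \<in> A" for a
      using * that A(1) yM R' R_le by fastforce
    then have "min R' (MIN a\<in>A. d a y) = R'"
      using A by (simp add: min_def)
    moreover have "min (l * s 0 / 8) (min R' (MIN a\<in>A. d a y) - min R' (MIN a\<in>A. d a x) - 16 * s (Suc n)) \<le> shortcut_dist x y"
      by (rule shortcut_dist_lower[OF A _ x yM(1)]) (rule const)
    ultimately have "min (l * s 0 / 8) (R - 16 * s (Suc n)) \<le> shortcut_dist x y"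
      using x_near by linarith
    then show False using yM r by (simp add: R_def)
  qed
  show thesis
  proof (cases "\<exists>e\<in>E (Suc n). d x e < R")
    case False
    have "S.mball x r \<subseteq> mball x (130 * r / l)"
    proof
      fix y assume y: "y \<in> S.mball x r"
      have far: "R \<le> d x (q m p b)" if "m \<le> n" "p \<in> P m" for m p b
        using False q_in_E[of p m "Suc n" b] that by force
      have "y \<in> (\<Union>a\<in>{x}. mball a (130 * r / l))"
        by (rule sub[of "{x}" R]) (use x R0 far y in \<open>auto simp: min_def\<close>)
      then show "y \<in> mball x (130 * r / l)" by blast
    qed
    then show thesis using x by (intro that[of x x]) auto
  next
    case True
    then obtain e where e: "e \<in> E (Suc n)" "d x e < R" by blast
    obtain m0 p0 b0 where 0: "m0 < Suc n" "p0 \<in> P m0" "e = q m0 p0 b0"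
      using e(1) by (rule E_cases)
    define A where "A = range (q m0 p0)"
    have A: "A \<subseteq> M" "finite A" "A \<noteq> {}" using q_M[OF 0(2)] by (auto simp: A_def)
    have AE: "A \<subseteq> E (Suc n)" using q_in_E[OF 0(2,1)] by (auto simp: A_def)
    have eA: "e \<in> A" using 0 by (simp add: A_def)
    have const: "min (2 * R) (MIN a\<in>A. d a (q m p True)) = min (2 * R) (MIN a\<in>A. d a (q m p False))"
      if mp: "m \<le> n" "p \<in> P m" for m p
    proof (cases "m = m0 \<and> p = p0")
      case True
      have "(MIN a\<in>A. d a z) = 0" if "z \<in> A" for z
      proof (rule Min_eqI)
        show "0 \<in> (\<lambda>a. d a z) ` A" using that A by force
      qed (use A in auto)
      then show ?thesis using True by (simp add: A_def)
    next
      case False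
      have "min (2 * R) (MIN a\<in>A. d a (q m p b)) = 2 * R" for b
      proof -
        have "2 * R \<le> d a (q m p b)" if "a \<in> A" for a
        proof -
          have "a \<noteq> q m p b" using that q_inj[OF 0(2) mp(2)] False by (auto simp: A_def)
          moreover have "q m p b \<in> E (Suc n)" using mp by (intro q_in_E) auto
          ultimately have "l * s n \<le> d a (q m p b)" using that AE by (intro E_sep) auto
          then show ?thesis using R_le' by simp
        qed
        then show ?thesis using A by (simp add: min_def)
      qed
      then show ?thesis by simp
    qed
    have "(MIN a\<in>A. d a x) \<le> d e x" using A eA by (intro Min_le) auto
    then have near: "min (2 * R) (MIN a\<in>A. d a x) \<le> 2 * R - R" using e by (simp add: commute min_def)
    have "S.mball x r \<subseteq> (\<Union>a\<in>A. mball a (130 * r / l))"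
      using sub[OF A order_refl const near] by blast
    also have "\<dots> = mball (q m0 p0 True) (130 * r / l) \<union> mball (q m0 p0 False) (130 * r / l)"
      by (simp add: A_def UNIV_bool Un_commute)
    finally show thesis using q_M[OF 0(2)] by (intro that)
  qed
qed

end

subsection \<open>Regularity and absence of biLipschitz pieces\<close>

lemma ennreal_eq_0_if_multiples_bounded:
  fixes x :: ennreal
  assumes "\<And>k::nat. of_nat k * x \<le> ennreal c" shows "x = 0"
proof (rule ccontr)
  assume "x \<noteq> 0"
  have "x \<le> ennreal c" using assms[of 1] by simp
  then obtain y where y: "x = ennreal y" "y \<ge> 0"
    by (cases x) (auto simp: top_unique)
  with \<open>x \<noteq> 0\<close> have "y > 0" by auto
  then obtain k :: nat where k: "max c 0 < real k * y" using reals_Archimedean3 by blast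
  have "ennreal (real k * y) \<le> ennreal c"
    using assms[of k] y by (simp add: ennreal_mult ennreal_of_nat_eq_real_of_nat)
  also have "ennreal c = ennreal (max c 0)" by (simp add: max_def ennreal_neg)
  finally have "real k * y \<le> max c 0" by (simp add: ennreal_le_iff)
  then show False using k by simp
qed

locale regular_shortcut_space = shortcut_space +
  fixes Q C :: real
  assumes Q_pos: "Q > 0" and C_ge_1: "C \<ge> 1"
    and H_ball_lower: "\<And>x r. x \<in> M \<Longrightarrow> 0 < r \<Longrightarrow> r \<le> D \<Longrightarrow>
      ennreal (1 / C * r powr Q) \<le> hausdorff M d Q (mball x r)"
    and H_ball_upper: "\<And>x r. x \<in> M \<Longrightarrow> 0 < r \<Longrightarrow> r \<le> D \<Longrightarrow>
      hausdorff M d Q (mball x r) \<le> ennreal (C * r powr Q)"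
begin

abbreviation H :: "'a set \<Rightarrow> ennreal" where "H \<equiv> hausdorff M d Q"

lemma H_shortcut_dist_ball:
  assumes "x \<in> M" "0 < r" "r \<le> l * s 0 / 8"
  shows "H (Metric_space.mball M shortcut_dist x r) \<le> ennreal (2 * C * (130 / l) powr Q * r powr Q)"
proof -
  obtain u v where uv: "u \<in> M" "v \<in> M"
    "Metric_space.mball M shortcut_dist x r \<subseteq> mball u (130 * r / l) \<union> mball v (130 * r / l)"
    using shortcut_dist_ball_cover[OF assms] by blast
  \<comment> \<open>Together with \<open>s 0 \<le> D / 100\<close> this keeps the radius
    \<open>130 * r / l\<close> within the range of regularity.\<close>
  have "r / l \<le> s 0 / 8" using assms(3) l_pos by (simp add: pos_divide_le_eq mult.commute)
  then have R: "0 < 130 * r / l" "130 * r / l \<le> D"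
    using assms l_pos s_le_D[of 0] D_pos by auto
  have "H (Metric_space.mball M shortcut_dist x r) \<le> H (mball u (130 * r / l)) + H (mball v (130 * r / l))"
    using hausdorff_mono[OF uv(3)] hausdorff_Un_le order_trans by blast
  also have "\<dots> \<le> ennreal (C * (130 * r / l) powr Q) + ennreal (C * (130 * r / l) powr Q)"
    by (intro add_mono H_ball_upper uv R)
  also have "\<dots> = ennreal (C * (130 * r / l) powr Q + C * (130 * r / l) powr Q)"
    using C_ge_1 by (intro ennreal_plus[symmetric]) auto
  also have "C * (130 * r / l) powr Q + C * (130 * r / l) powr Q = 2 * C * (130 / l) powr Q * r powr Q"
    using assms l_pos powr_mult[of "130 / l" r Q] by simp
  finally show ?thesis .
qed

text \<open>The constant of \<open>H_shortcut_dist_ball\<close> for radius \<open>2 * t\<close>,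
  relative to \<open>t powr Q\<close>.\<close>

definition K :: real where "K = 2 * C * (260 / l) powr Q"

lemma K_ge_1: "K \<ge> 1"
proof -
  have "1 \<le> (260 / l) powr Q"
    using l_pos l_less_1 Q_pos by (intro ge_one_powr_ge_zero) (auto simp: field_simps)
  moreover have "1 \<le> 2 * C" using C_ge_1 by simp
  ultimately show ?thesis unfolding K_def using mult_mono[of 1 "2 * C" 1 "(260 / l) powr Q"] by simp
qed

text \<open>A set of new diameter \<open>t > 0\<close> lies in an open new ball of radius
  \<open>2 * t\<close>, whose old measure is controlled. For \<open>t = 0\<close> that ball would be
  empty, but then the set has at most one point.\<close>

lemma H_le_H_shortcut_dist: "H A \<le> ennreal K * hausdorff M shortcut_dist Q A"
proof (rule hausdorff_le_if_small_sets)
  interpret S: Metric_space M shortcut_dist by (rule Metric_space_shortcut_dist)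
  show "l * s 0 / 16 > 0" using l_pos s_pos[of 0] by simp
  show "K > 0" using K_ge_1 by simp
  fix S assume S: "S \<subseteq> M" "diam shortcut_dist S \<le> ennreal (l * s 0 / 16)"
  define t where "t = enn2real (diam shortcut_dist S)"
  have t: "diam shortcut_dist S = ennreal t" "t \<ge> 0"
    using S(2) by (auto simp: t_def ennreal_enn2real_if top_unique)
  have t_le: "t \<le> l * s 0 / 16"
    using S(2) t l_pos s_pos[of 0] by (simp add: ennreal_le_iff)
  have shortcut_dist_t: "shortcut_dist x y \<le> t" if "x \<in> S" "y \<in> S" for x y
    using diam_upper[of x S y shortcut_dist] that t by (simp add: ennreal_le_iff)
  consider "S = {}" | "S \<noteq> {}" "t = 0" | x where "x \<in> S" "t > 0" using t(2) by fastforce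
  then have "H S \<le> ennreal (K * t powr Q)"
  proof cases
    case 2
    have "d x y = 0" if "x \<in> S" "y \<in> S" for x y
    proof -
      have "shortcut_dist x y = 0" using shortcut_dist_t[OF that] 2(2) S.nonneg[of x y] by simp
      then show ?thesis using that S(1) by (simp add: subset_iff)
    qed
    then have "diam d S = 0" using 2(1) by (simp add: diam_def)
    then show ?thesis using hausdorff_eq_0_if_diam_eq_0[OF S(1)] by simp
  next
    case 3
    have "S \<subseteq> S.mball x (2 * t)"
      using S(1) 3 shortcut_dist_t by fastforce
    then have "H S \<le> H (S.mball x (2 * t))" by (rule hausdorff_mono)
    also have "\<dots> \<le> ennreal (2 * C * (130 / l) powr Q * (2 * t) powr Q)"
      using 3 S(1) t_le by (intro H_shortcut_dist_ball) auto
    also have "2 * C * (130 / l) powr Q * (2 * t) powr Q = K * t powr Q"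
      using 3 l_pos powr_mult[of "130 / l" "2 * t" Q] powr_mult[of "260 / l" t Q] by (simp add: K_def)
    finally show ?thesis .
  qed simp
  then show "H S \<le> ennreal (K * enn2real (diam shortcut_dist S) powr Q)" by (simp add: t_def)
qed

text \<open>Upper bound: the new measure is at most the old one, which is controlled on new balls.
  Lower bound: a new ball contains the old ball of the same radius, and \<open>H\<close> is at most
  \<open>K\<close> times the new measure.\<close>

lemma ahlfors_regular_shortcut_dist: "ahlfors_regular M shortcut_dist Q"
proof -
  interpret S: Metric_space M shortcut_dist by (rule Metric_space_shortcut_dist)
  have "1 \<le> C * K" using mult_mono[of 1 C 1 K] C_ge_1 K_ge_1 by simp
  moreover have "ennreal (1 / (C * K) * r powr Q) \<le> hausdorff M shortcut_dist Q (S.mball x r) \<and>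
      hausdorff M shortcut_dist Q (S.mball x r) \<le> ennreal (C * K * r powr Q)"
    if x: "x \<in> M" and r: "r > 0" "ennreal r < diam shortcut_dist M / 2" for x r
  proof -
    have "diam shortcut_dist M \<le> ennreal (l * s 0 / 8)"
      unfolding diam_def by (intro SUP_least ennreal_leI shortcut_dist_le_max)
    then have "diam shortcut_dist M / 2 \<le> ennreal (l * s 0 / 8) / 2" by (rule divide_right_mono_ennreal)
    also have "\<dots> = ennreal (l * s 0 / 16)"
      using l_pos s_pos[of 0] by (subst ennreal_divide_numeral) auto
    finally have "ennreal r < ennreal (l * s 0 / 16)" using r(2) by (rule less_le_trans[rotated])
    then have r_less: "r < l * s 0 / 16"
      using r l_pos s_pos[of 0] by (simp add: ennreal_less_iff)
    have ls: "0 < l * s 0" "l * s 0 \<le> s 0" using l_pos l_less_1 s_pos[of 0] by auto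
    have r_small: "r \<le> l * s 0 / 8" "r \<le> D" using r_less ls s_le_D[of 0] D_pos by auto
    have "hausdorff M shortcut_dist Q (S.mball x r) \<le> H (S.mball x r)"
      by (intro hausdorff_le_cong shortcut_dist_le Q_pos)
    also have "\<dots> \<le> ennreal (2 * C * (130 / l) powr Q * r powr Q)"
      by (intro H_shortcut_dist_ball x r r_small)
    also have "\<dots> \<le> ennreal (C * K * r powr Q)"
    proof (intro ennreal_leI mult_right_mono)
      have "(130 / l) powr Q \<le> (260 / l) powr Q"
        using l_pos Q_pos by (intro powr_mono2 divide_right_mono) auto
      then have "2 * C * (130 / l) powr Q \<le> K"
        unfolding K_def using C_ge_1 by (intro mult_left_mono) auto
      also have "K \<le> C * K" using C_ge_1 K_ge_1 by simp
      finally show "2 * C * (130 / l) powr Q \<le> C * K" .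
    qed simp
    finally have upper: "hausdorff M shortcut_dist Q (S.mball x r) \<le> ennreal (C * K * r powr Q)" .
    have "mball x r \<subseteq> S.mball x r" using shortcut_dist_le by fastforce
    then have "ennreal (1 / C * r powr Q) \<le> H (S.mball x r)"
      using H_ball_lower[OF x r(1) r_small(2)] hausdorff_mono order_trans by blast
    also have "\<dots> \<le> ennreal K * hausdorff M shortcut_dist Q (S.mball x r)" by (rule H_le_H_shortcut_dist)
    finally have "ennreal (1 / C * r powr Q) / ennreal K \<le> hausdorff M shortcut_dist Q (S.mball x r)"
      using K_ge_1 by (intro divide_le_posI_ennreal) auto
    moreover have "ennreal (1 / C * r powr Q) / ennreal K = ennreal (1 / (C * K) * r powr Q)"
      using K_ge_1 C_ge_1 by (subst divide_ennreal) auto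
    ultimately show ?thesis using upper by simp
  qed
  ultimately show ?thesis unfolding ahlfors_regular_def by blast
qed

section \<open>Porosity of sets on which the distances are biLipschitz equivalent\<close>

text \<open>If \<open>A\<close> met the balls about both ends of a shortcut, two of its points would
  be almost \<open>l * s n\<close> apart for \<open>d\<close> but only about
  \<open>w n + 2 * e * s n\<close> for the new distance. With \<open>e = l / (8 * L)\<close> and
  small \<open>w n\<close> this contradicts the factor \<open>L\<close>.\<close>

lemma hole_near:
  assumes A: "A \<subseteq> M" and L: "L \<ge> 1" "\<And>a a'. a \<in> A \<Longrightarrow> a' \<in> A \<Longrightarrow> d a a' \<le> L * shortcut_dist a a'"
    and e: "e = l / (8 * L)" and w: "w n < l * e / 4 * s n" and x: "x \<in> M"
  obtains h where "h \<in> M" "d x h < 13 * s n / l" "mball h (e * s n) \<inter> A = {}"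
proof -
  interpret S: Metric_space M shortcut_dist by (rule Metric_space_shortcut_dist)
  obtain p where p: "p \<in> P n" "d x p < 12 * s n / l" using P_near[OF x] .
  have near: "d x (q n p b) < 13 * s n / l" for b
  proof -
    have "d x (q n p b) < 12 * s n / l + s n"
      using triangle[OF x P_M[OF p(1)] q_M[OF p(1), of b]] p(2) q_dist[OF p(1), of b] by simp
    also have "\<dots> \<le> 13 * s n / l" using s_pos[of n] l_pos l_less_1 by (simp add: field_simps)
    finally show ?thesis .
  qed
  have "\<exists>b. mball (q n p b) (e * s n) \<inter> A = {}"
  proof (rule ccontr)
    assume "\<not> ?thesis"
    then have "\<forall>b. \<exists>a. a \<in> mball (q n p b) (e * s n) \<and> a \<in> A" by blast
    then obtain a where a: "\<And>b. a b \<in> mball (q n p b) (e * s n)" "\<And>b. a b \<in> A" by metis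
    have aM: "a b \<in> M" "d (q n p b) (a b) < e * s n" for b using a(1)[of b] by auto
    have qM: "q n p b \<in> M" for b using q_M[OF p(1)] .
    have "l * s n \<le> d (q n p True) (q n p False)" using q_far[OF p(1), of True] by simp
    also have "\<dots> \<le> d (q n p True) (a True) + d (a True) (a False) + d (q n p False) (a False)"
      using triangle[OF qM[of True] aM(1)[of True] qM[of False]]
        triangle'[OF aM(1)[of True] aM(1)[of False] qM[of False]] by simp
    also have "\<dots> < d (a True) (a False) + 2 * (e * s n)"
      using aM(2)[of True] aM(2)[of False] by simp
    finally have far: "l * s n < d (a True) (a False) + 2 * (e * s n)" .
    have "shortcut_dist (a True) (a False) \<le> shortcut_dist (q n p True) (a True) + shortcut_dist (q n p True) (q n p False) + shortcut_dist (q n p False) (a False)"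
      using S.triangle''[OF aM(1)[of True] qM[of True] aM(1)[of False]]
        S.triangle[OF qM[of True] qM[of False] aM(1)[of False]] by simp
    also have "\<dots> \<le> 2 * (e * s n) + w n"
      using shortcut_dist_le[OF qM aM(1), of True True] shortcut_dist_le[OF qM aM(1), of False False]
        aM(2)[of True] aM(2)[of False] shortcut_dist_q[OF p(1)] by simp
    finally have "shortcut_dist (a True) (a False) \<le> 2 * (e * s n) + w n" .
    then have "L * shortcut_dist (a True) (a False) \<le> L * (2 * (e * s n) + w n)" using L by (intro mult_left_mono) auto
    then have "d (a True) (a False) \<le> L * (2 * (e * s n) + w n)"
      using L(2)[OF a(2) a(2), of True False] by simp
    also have "\<dots> = l * s n / 4 + L * w n" using L e by (simp add: field_simps)
    also have "L * w n \<le> L * (l * e / 4 * s n)" using w L by (intro mult_left_mono) auto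
    also have "\<dots> = l * (l * s n) / 32" using L e by (simp add: field_simps)
    also have "\<dots> \<le> 1 * (l * s n) / 32"
      using l_pos l_less_1 s_pos[of n] by (intro divide_right_mono mult_right_mono) auto
    finally have "d (a True) (a False) \<le> l * s n / 4 + l * s n / 32" by simp
    moreover have "e * s n \<le> l * s n / 8"
    proof -
      have "e \<le> l / 8" unfolding e using L(1) l_pos by (intro divide_left_mono) auto
      then have "e * s n \<le> l / 8 * s n" using s_pos[of n] by (intro mult_right_mono) auto
      then show ?thesis by simp
    qed
    ultimately show False using far mult_pos_pos[OF l_pos s_pos[of n]] by linarith
  qed
  then obtain b where "mball (q n p b) (e * s n) \<inter> A = {}" by blast
  then show thesis using that[OF q_M[OF p(1)] near] by blast
qed


text \<open>\<open>W\<close> is the union of one hole for each point of a maximal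
  \<open>t\<close>-separated set \<open>N\<close> in the given part of \<open>A\<close>. The balls
  of radius \<open>t\<close> about \<open>N\<close> cover that part, so its measure is at most
  \<open>C * t powr Q\<close> times the number of holes, while each hole has measure at least
  \<open>r powr Q / C\<close>; the quotient \<open>t / r\<close> is
  \<open>100 / (l * e)\<close>.\<close>

lemma porous_scale:
  assumes A: "A \<subseteq> M" and L: "L \<ge> 1" "\<And>a a'. a \<in> A \<Longrightarrow> a' \<in> A \<Longrightarrow> d a a' \<le> L * shortcut_dist a a'"
    and e: "e = l / (8 * L)" and w: "w n < l * e / 4 * s n" and x0: "x0 \<in> M"
  shows "\<exists>W\<subseteq>mball x0 D. H (A \<inter> mball x0 (D / 2)) \<le> ennreal (C\<^sup>2 * (100 / (l * e)) powr Q) * H W \<and>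
    (\<forall>z\<in>W. (\<exists>a\<in>A. d a z < 14 * s n / l) \<and> (\<forall>a\<in>A. e * s n / 2 \<le> d a z))"
proof -
  \<comment> \<open>Half the radius of the hole, so that the points of \<open>W\<close> keep the
    other half as distance from \<open>A\<close>.\<close>
  define r where "r = e * s n / 2"
  \<comment> \<open>Holes stay within \<open>14 * s n / l\<close> of their net points, so this
    spacing separates different holes.\<close>
  define t where "t = 50 * s n / l"
  have e_pos: "e > 0" "e \<le> 1"
    unfolding e using L(1) l_pos l_less_1 by (auto simp: divide_le_eq)
  have sl: "s n \<le> s n / l" using s_pos[of n] l_pos l_less_1 by (simp add: field_simps)
  have slD: "s n / l \<le> D / 100" using s_le[of n] l_pos by (simp add: pos_divide_le_eq mult.commute)
  have r_pos: "r > 0" "r \<le> s n" using e_pos s_pos[of n] by (auto simp: r_def mult_le_one)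
  have r_sl: "2 * r \<le> s n / l"
  proof -
    have "2 * r \<le> 1 * s n" unfolding r_def using e_pos s_pos[of n] by simp
    then show ?thesis using sl by simp
  qed
  have rD: "r \<le> D" using r_sl r_pos(1) slD D_pos by linarith
  have "t = 50 * (s n / l)" by (simp add: t_def)
  then have t_pos: "t > 0" "t \<le> D" using slD D_pos divide_pos_pos[OF s_pos l_pos, of n] by linarith+
  have "A \<inter> mball x0 (D / 2) \<subseteq> M" using A by blast
  from maximal_separated_subset[OF t_pos(1) this]
  obtain N where NA: "N \<subseteq> A \<inter> mball x0 (D / 2)"
    and N_sep: "\<forall>x\<in>N. \<forall>y\<in>N. x \<noteq> y \<longrightarrow> t \<le> d x y"
    and N_max: "\<forall>y\<in>A \<inter> mball x0 (D / 2). \<exists>p\<in>N. d y p < t"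
    by (elim exE conjE)
  have NM: "x \<in> M" if "x \<in> N" for x using NA that by auto
  have "\<forall>x\<in>N. \<exists>h. h \<in> M \<and> d x h < 13 * s n / l \<and> mball h (e * s n) \<inter> A = {}"
    using hole_near[OF A L e w NM] by metis
  then obtain h where h: "\<And>x. x \<in> N \<Longrightarrow> h x \<in> M" "\<And>x. x \<in> N \<Longrightarrow> d x (h x) < 13 * s n / l"
    "\<And>x. x \<in> N \<Longrightarrow> mball (h x) (e * s n) \<inter> A = {}"
    by metis
  define B where "B x = mball (h x) r" for x
  have B_near: "d x z < 14 * s n / l" if "x \<in> N" "z \<in> B x" for x z
  proof -
    have "d x z < 13 * s n / l + r"
      using triangle[OF NM h(1), of x x z] h(2)[of x] that by (auto simp: B_def)
    then show ?thesis using r_sl r_pos by simp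
  qed
  have B_sub: "B x \<subseteq> mball x0 D" if "x \<in> N" for x
  proof
    fix z assume z: "z \<in> B x"
    then have zM: "z \<in> M" by (auto simp: B_def)
    have "d x0 x < D / 2" using NA that by auto
    then have "d x0 z < D / 2 + 14 * (s n / l)"
      using triangle[OF x0 NM[OF that] zM] B_near[OF that z] by simp
    then show "z \<in> mball x0 D" using slD D_pos x0 zM by simp
  qed
  have B_sep: "\<exists>\<eta>>0. \<forall>a\<in>B x. \<forall>b\<in>B y. \<eta> \<le> d a b" if xy: "x \<in> N" "y \<in> N" "x \<noteq> y" for x y
  proof (intro exI[of _ "s n / l"] conjI ballI)
    show "s n / l > 0" using s_pos[of n] l_pos by simp
    fix a b assume ab: "a \<in> B x" "b \<in> B y"
    then have abM: "a \<in> M" "b \<in> M" by (auto simp: B_def)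
    have "50 * (s n / l) \<le> d x y" using N_sep xy by (simp add: t_def)
    also have "\<dots> \<le> d x a + d a b + d y b"
      using triangle[OF NM abM(1) NM, OF xy(1,2)] triangle'[OF abM NM, OF xy(2)] by simp
    also have "\<dots> < d a b + 28 * (s n / l)"
      using B_near[OF xy(1) ab(1)] B_near[OF xy(2) ab(2)] by simp
    finally show "s n / l \<le> d a b" using s_pos[of n] sl by simp
  qed
  have lower: "(\<Sum>x\<in>F. H (B x)) \<le> H (\<Union>x\<in>F. B x)" if "finite F" "F \<subseteq> N" for F
    using that by (intro hausdorff_finite_UN_superadditive B_sep) (auto dest: subsetD)
  define v where "v = 1 / C * r powr Q"
  have v_pos: "v > 0" using C_ge_1 r_pos by (simp add: v_def)
  have HB: "ennreal v \<le> H (B x)" if "x \<in> N" for x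
    unfolding B_def v_def using h(1)[OF that] r_pos(1) rD by (intro H_ball_lower)
  have count: "of_nat (card F) * ennreal v \<le> H (\<Union>x\<in>F. B x)" if "finite F" "F \<subseteq> N" for F
  proof -
    have "of_nat (card F) * ennreal v = (\<Sum>x\<in>F. ennreal v)" by simp
    also have "\<dots> \<le> (\<Sum>x\<in>F. H (B x))" using that HB by (intro sum_mono) auto
    finally show ?thesis using lower[OF that] by simp
  qed
  \<comment> \<open>Separated holes of measure at least \<open>v\<close> in a ball of finite
    measure: finite subsets of \<open>N\<close> have bounded size.\<close>
  have "finite N \<and> card N \<le> nat \<lceil>C * D powr Q / v\<rceil>"
  proof (rule finite_if_finite_subsets_card_bdd)
    fix F assume F: "F \<subseteq> N" "finite F"
    have "of_nat (card F) * ennreal v \<le> H (\<Union>x\<in>F. B x)" by (rule count[OF F(2,1)])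
    also have "\<dots> \<le> H (mball x0 D)" using B_sub F by (intro hausdorff_mono) blast
    also have "\<dots> \<le> ennreal (C * D powr Q)" using D_pos x0 by (intro H_ball_upper) auto
    finally have "ennreal (real (card F) * v) \<le> ennreal (C * D powr Q)"
      using v_pos by (simp add: ennreal_mult ennreal_of_nat_eq_real_of_nat)
    then have "real (card F) * v \<le> C * D powr Q"
      using C_ge_1 by (subst (asm) ennreal_le_iff) auto
    then have "real (card F) \<le> C * D powr Q / v" using v_pos by (simp add: field_simps)
    then show "card F \<le> nat \<lceil>C * D powr Q / v\<rceil>" by linarith
  qed
  then have finN: "finite N" ..
  define W where "W = (\<Union>x\<in>N. B x)"
  define c where "c = C\<^sup>2 * (100 / (l * e)) powr Q"
  have cv: "C * t powr Q = c * v"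
  proof -
    have "t = 100 / (l * e) * r" using e_pos l_pos by (simp add: t_def r_def field_simps)
    then have "t powr Q = (100 / (l * e)) powr Q * r powr Q"
      using e_pos l_pos r_pos by (simp only: powr_mult)
    then show ?thesis using C_ge_1 by (simp add: c_def v_def power2_eq_square)
  qed
  have c0: "c \<ge> 0" by (simp add: c_def)
  have "H (A \<inter> mball x0 (D / 2)) \<le> H (\<Union>x\<in>N. mball x t)"
  proof (rule hausdorff_mono, rule subsetI)
    fix y assume y: "y \<in> A \<inter> mball x0 (D / 2)"
    then obtain p where "p \<in> N" "d y p < t" using N_max by blast
    then show "y \<in> (\<Union>x\<in>N. mball x t)" using y NM by (auto simp: commute)
  qed
  also have "\<dots> \<le> (\<Sum>x\<in>N. H (mball x t))" by (rule hausdorff_finite_UN_le[OF finN])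
  also have "\<dots> \<le> (\<Sum>x\<in>N. ennreal (C * t powr Q))"
    using NM t_pos by (intro sum_mono H_ball_upper) auto
  also have "\<dots> = ennreal c * (of_nat (card N) * ennreal v)"
    using cv c0 v_pos by (simp add: ennreal_mult mult.left_commute)
  also have "\<dots> \<le> ennreal c * H W"
    unfolding W_def by (intro mult_left_mono count finN) auto
  finally have "H (A \<inter> mball x0 (D / 2)) \<le> ennreal c * H W" .
  moreover have "W \<subseteq> mball x0 D" using B_sub by (auto simp: W_def)
  moreover have "\<exists>a\<in>A. d a z < 14 * s n / l" if "z \<in> W" for z
    using that NA B_near by (auto simp: W_def)
  moreover have "e * s n / 2 \<le> d a z" if z: "z \<in> W" and a: "a \<in> A" for z a
  proof -
    obtain x where x: "x \<in> N" "z \<in> B x" using z by (auto simp: W_def)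
    then have zM: "z \<in> M" "d (h x) z < e * s n / 2" by (auto simp: B_def r_def)
    have aM: "a \<in> M" using a A by auto
    have "a \<notin> mball (h x) (e * s n)" using h(3)[OF x(1)] a by blast
    then have "e * s n \<le> d (h x) a" using h(1)[OF x(1)] aM by simp
    also have "\<dots> \<le> d (h x) z + d a z" using triangle'[OF h(1)[OF x(1)] zM(1) aM] .
    finally show ?thesis using zM(2) by simp
  qed
  ultimately show ?thesis unfolding c_def by blast
qed

text \<open>The hole sets of \<open>k\<close> scales are positively separated subsets of one ball of
  finite measure, and each has at least \<open>1 / c\<close> times the measure of the part of
  \<open>A\<close>. So \<open>k\<close> times this measure is bounded independently of
  \<open>k\<close>.\<close>

lemma bilipschitz_null_local:
  assumes A: "A \<subseteq> M" and bilip: "bilipschitz_equivalent_on A shortcut_dist d" and x0: "x0 \<in> M"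
  shows "H (A \<inter> mball x0 (D / 2)) = 0"
proof -
  obtain L where L: "L \<ge> 1" and bl: "\<forall>p\<in>A. \<forall>q\<in>A. 1 / L * d p q \<le> shortcut_dist p q \<and> shortcut_dist p q \<le> L * d p q"
    using bilip unfolding bilipschitz_equivalent_on_def by blast
  have dL: "d a a' \<le> L * shortcut_dist a a'" if "a \<in> A" "a' \<in> A" for a a'
    using bl[rule_format, OF that] L by (simp add: field_simps)
  define e where "e = l / (8 * L)"
  have e_pos: "e > 0" using L l_pos by (simp add: e_def)
  have "eventually (\<lambda>n. w n / s n < l * e / 4) sequentially"
    by (rule order_tendstoD[OF w_over_s_tendsto_0]) (use e_pos l_pos in simp)
  then obtain n1 where n1: "\<And>n. n \<ge> n1 \<Longrightarrow> w n / s n < l * e / 4"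
    by (auto simp: eventually_sequentially)
  have w_less: "w n < l * e / 4 * s n" if "n \<ge> n1" for n
    using n1[OF that] s_pos[of n] by (simp add: pos_divide_less_eq)
  define c where "c = C\<^sup>2 * (100 / (l * e)) powr Q"
  have "\<forall>n. \<exists>W. n \<ge> n1 \<longrightarrow> (W \<subseteq> mball x0 D \<and> H (A \<inter> mball x0 (D / 2)) \<le> ennreal c * H W \<and>
    (\<forall>z\<in>W. (\<exists>a\<in>A. d a z < 14 * s n / l) \<and> (\<forall>a\<in>A. e * s n / 2 \<le> d a z)))"
    using porous_scale[OF A L dL e_def w_less x0] unfolding c_def by blast
  then obtain W where W_sub: "\<And>n. n \<ge> n1 \<Longrightarrow> W n \<subseteq> mball x0 D"
    and W_H: "\<And>n. n \<ge> n1 \<Longrightarrow> H (A \<inter> mball x0 (D / 2)) \<le> ennreal c * H (W n)"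
    and W_near: "\<And>n z. n \<ge> n1 \<Longrightarrow> z \<in> W n \<Longrightarrow> \<exists>a\<in>A. d a z < 14 * s n / l"
    and W_far: "\<And>n z a. n \<ge> n1 \<Longrightarrow> z \<in> W n \<Longrightarrow> a \<in> A \<Longrightarrow> e * s n / 2 \<le> d a z"
    by metis
  have sep: "e * s n / 4 \<le> d y z" if n: "n \<ge> n1" "n < m" and y: "y \<in> W n" and z: "z \<in> W m" for n m y z
  proof -
    have m: "m \<ge> n1" using n by simp
    obtain a where a: "a \<in> A" "d a z < 14 * s m / l" using W_near[OF m z] by blast
    have M: "a \<in> M" "y \<in> M" "z \<in> M" using a A W_sub[OF n(1)] W_sub[OF m] y z by auto
    have "s m \<le> s (Suc n)" using n by (intro s_antimono) auto
    \<comment> \<open>Since \<open>w n\<close> is \<open>20 * s (Suc n)\<close>, its smallness also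
      says that finer holes lie much closer to \<open>A\<close> than the coarser ones.\<close>
    also have "\<dots> \<le> l * e / 80 * s n" using w_less[OF n(1)] by (simp add: w_def)
    finally have "14 * s m / l \<le> 14 * e / 80 * s n" using l_pos by (simp add: field_simps)
    moreover have "e * s n / 2 \<le> d a y" by (rule W_far[OF n(1) y a(1)])
    moreover have "d a y \<le> d a z + d y z" using triangle'[OF M(1,3,2)] by (simp add: commute)
    moreover have "e * s n > 0" using e_pos s_pos[of n] by simp
    ultimately show ?thesis using a(2) by simp
  qed
  show ?thesis
  proof (rule ennreal_eq_0_if_multiples_bounded)
    fix k :: nat
    have "of_nat k * H (A \<inter> mball x0 (D / 2)) = (\<Sum>n\<in>{n1..<n1 + k}. H (A \<inter> mball x0 (D / 2)))"
      by simp
    also have "\<dots> \<le> (\<Sum>n\<in>{n1..<n1 + k}. ennreal c * H (W n))"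
      by (intro sum_mono W_H) auto
    also have "\<dots> = ennreal c * (\<Sum>n\<in>{n1..<n1 + k}. H (W n))" by (simp add: sum_distrib_left)
    also have "\<dots> \<le> ennreal c * H (\<Union>n\<in>{n1..<n1 + k}. W n)"
    proof (intro mult_left_mono hausdorff_finite_UN_superadditive)
      fix i j assume ij: "i \<in> {n1..<n1 + k}" "j \<in> {n1..<n1 + k}" "i \<noteq> j"
      show "\<exists>\<eta>>0. \<forall>a\<in>W i. \<forall>b\<in>W j. \<eta> \<le> d a b"
      proof (intro exI[of _ "e * s (min i j) / 4"] conjI ballI)
        show "e * s (min i j) / 4 > 0" using e_pos s_pos by simp
        fix a b assume "a \<in> W i" "b \<in> W j"
        then show "e * s (min i j) / 4 \<le> d a b"
          using sep[of i j a b] sep[of j i b a] ij by (cases "i < j") (auto simp: commute min_def)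
      qed
    qed auto
    also have "\<dots> \<le> ennreal c * H (mball x0 D)"
      using W_sub by (intro mult_left_mono hausdorff_mono UN_least) simp_all
    also have "\<dots> \<le> ennreal c * ennreal (C * D powr Q)"
      using x0 D_pos by (intro mult_left_mono H_ball_upper) auto
    also have "\<dots> = ennreal (c * (C * D powr Q))"
      using C_ge_1 by (simp add: ennreal_mult c_def)
    finally show "of_nat k * H (A \<inter> mball x0 (D / 2)) \<le> ennreal (c * (C * D powr Q))" .
  qed
qed

text \<open>Separability provides countably many balls of radius \<open>D / 2\<close> that cover the
  space, and the local statement applies to each.\<close>

lemma bilipschitz_null:
  assumes sep: "separable_space mtopology"
    and A: "A \<subseteq> M" and bilip: "bilipschitz_equivalent_on A shortcut_dist d"
  shows "H A = 0"
proof (cases "A = {}")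
  case False
  obtain S where S: "countable S" "S \<subseteq> M" "mtopology closure_of S = M"
    using sep unfolding separable_space_def by auto
  have near: "\<exists>y\<in>S. d x y < D / 2" if "x \<in> M" for x
  proof -
    have "x \<in> mtopology closure_of S" using that S(3) by simp
    then have "\<forall>r>0. \<exists>y\<in>S. y \<in> mball x r" unfolding metric_closure_of by simp
    then obtain y where "y \<in> S" "y \<in> mball x (D / 2)"
      using D_pos half_gt_zero by blast
    then show ?thesis by auto
  qed
  have "S \<noteq> {}" using near False A by blast
  have "A \<subseteq> (\<Union>i. A \<inter> mball (from_nat_into S i) (D / 2))"
  proof
    fix x assume x: "x \<in> A"
    then obtain y where y: "y \<in> S" "d x y < D / 2" using near A by blast
    obtain i where "from_nat_into S i = y" using from_nat_into_surj[OF S(1) y(1)] by blast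
    then show "x \<in> (\<Union>i. A \<inter> mball (from_nat_into S i) (D / 2))"
      using x y A S(2) by (auto simp: commute intro!: exI[of _ i])
  qed
  then have "H A \<le> H (\<Union>i. A \<inter> mball (from_nat_into S i) (D / 2))" by (rule hausdorff_mono)
  also have "\<dots> \<le> (\<Sum>i. H (A \<inter> mball (from_nat_into S i) (D / 2)))"
    by (rule hausdorff_countably_subadditive)
  also have "\<dots> = (\<Sum>i. 0)"
    using bilipschitz_null_local[OF A bilip] from_nat_into[OF \<open>S \<noteq> {}\<close>] S(2) by (intro suminf_cong) blast
  finally show ?thesis by simp
qed simp

end

section \<open>From the hypotheses to the shortcut construction\<close>

theorem theorem1p3:
  fixes X :: "'a set" and \<rho> :: "'a \<Rightarrow> 'a \<Rightarrow> real" and Q :: real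
  assumes "Metric_space X \<rho>"
    and "separable_space (Metric_space.mtopology X \<rho>)"
    and "Q > 0"
    and "ahlfors_regular X \<rho> Q"
    and "\<exists>l::real. 0 < l \<and> l < 1 \<and>
           (\<forall>p\<in>X. \<forall>r::real. 0 < r \<and> ennreal r < diam \<rho> X \<longrightarrow>
              (\<exists>q1\<in>Metric_space.mball X \<rho> p r. \<exists>q2\<in>Metric_space.mball X \<rho> p r.
                 \<rho> q1 q2 \<ge> l * r \<and>
                 (\<forall>p1\<in>X - Metric_space.mball X \<rho> p r. \<forall>p2\<in>X - Metric_space.mball X \<rho> p r.
                    \<rho> p1 p2 \<le> \<rho> p1 q1 + \<rho> p2 q2)))"
  shows "\<exists>d :: 'a \<Rightarrow> 'a \<Rightarrow> real.
           Metric_space X d \<and>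
           (\<forall>p\<in>X. \<forall>q\<in>X. d p q \<le> \<rho> p q) \<and>
           ahlfors_regular X d Q \<and>
           (\<forall>A\<subseteq>X. hausdorff X \<rho> Q A > 0 \<longrightarrow> \<not> bilipschitz_equivalent_on A d \<rho>)"
proof (cases "diam \<rho> X = 0")
  case True
  \<comment> \<open>With at most one point there are no radii to work with, but all measures vanish
    and \<open>\<rho>\<close> itself serves as \<open>d\<close>.\<close>
  have "hausdorff X \<rho> Q A = 0" if "A \<subseteq> X" for A
  proof (rule hausdorff_eq_0_if_diam_eq_0[OF that])
    show "diam \<rho> A = 0" using diam_mono[OF that, of \<rho>] True by simp
  qed
  then show ?thesis using assms(1,4) by (intro exI[of _ \<rho>]) auto
next
  case False
  interpret Metric_space X \<rho> by (rule assms(1))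
  obtain l :: real where l: "0 < l" "l < 1"
    and pair: "\<And>p r. p \<in> X \<Longrightarrow> 0 < r \<Longrightarrow> ennreal r < diam \<rho> X \<Longrightarrow>
              (\<exists>q1\<in>mball p r. \<exists>q2\<in>mball p r. \<rho> q1 q2 \<ge> l * r \<and>
                 (\<forall>p1\<in>X - mball p r. \<forall>p2\<in>X - mball p r. \<rho> p1 p2 \<le> \<rho> p1 q1 + \<rho> p2 q2))"
    using assms(5) by blast
  obtain C where C: "C \<ge> 1" and reg: "\<And>x r. x \<in> X \<Longrightarrow> r > 0 \<Longrightarrow> ennreal r < diam \<rho> X / 2 \<Longrightarrow>
        ennreal (1 / C * r powr Q) \<le> hausdorff X \<rho> Q (mball x r) \<and>
        hausdorff X \<rho> Q (mball x r) \<le> ennreal (C * r powr Q)"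
    using assms(4) unfolding ahlfors_regular_def by blast
  have half: "diam \<rho> X / 2 \<le> diam \<rho> X"
    by (intro divide_le_posI_ennreal) (auto simp: mult_2)
  have "0 < diam \<rho> X / 2" using False by (simp add: ennreal_zero_less_divide zero_less_iff_neq_zero)
  \<comment> \<open>The diameter may be infinite; a value strictly below its half is finite and
    gives the real bound \<open>D\<close>.\<close>
  then obtain D' where D': "0 < D'" "D' < diam \<rho> X / 2" using dense by blast
  then obtain D where D: "0 < D" "ennreal D < diam \<rho> X / 2"
    by (cases D') auto
  have small: "ennreal r < diam \<rho> X / 2" "ennreal r < diam \<rho> X" if "r \<le> D" for r
    using ennreal_leI[OF that] D(2) half by (auto intro: le_less_trans less_le_trans)
  have "\<forall>r p. \<exists>f. p \<in> X \<longrightarrow> 0 < r \<longrightarrow> r \<le> D \<longrightarrow> (\<forall>b. f b \<in> mball p r) \<and> l * r \<le> \<rho> (f True) (f False) \<and>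
     (\<forall>p1\<in>X - mball p r. \<forall>p2\<in>X - mball p r. \<rho> p1 p2 \<le> \<rho> p1 (f True) + \<rho> p2 (f False))"
  proof (intro allI)
    fix r p
    show "\<exists>f. p \<in> X \<longrightarrow> 0 < r \<longrightarrow> r \<le> D \<longrightarrow> (\<forall>b. f b \<in> mball p r) \<and> l * r \<le> \<rho> (f True) (f False) \<and>
     (\<forall>p1\<in>X - mball p r. \<forall>p2\<in>X - mball p r. \<rho> p1 p2 \<le> \<rho> p1 (f True) + \<rho> p2 (f False))"
    proof (cases "p \<in> X \<and> 0 < r \<and> r \<le> D")
      case True
      then obtain q1 q2 where q: "q1 \<in> mball p r" "q2 \<in> mball p r" "\<rho> q1 q2 \<ge> l * r"
        "\<forall>p1\<in>X - mball p r. \<forall>p2\<in>X - mball p r. \<rho> p1 p2 \<le> \<rho> p1 q1 + \<rho> p2 q2"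
        using pair[of p r] small(2)[of r] by blast
      show ?thesis
        by (intro exI[of _ "\<lambda>b. if b then q1 else q2"] impI conjI allI) (use q in auto)
    qed auto
  qed
  then obtain pr where pr: "\<And>r p. p \<in> X \<Longrightarrow> 0 < r \<Longrightarrow> r \<le> D \<Longrightarrow> (\<forall>b. pr r p b \<in> mball p r) \<and> l * r \<le> \<rho> (pr r p True) (pr r p False) \<and>
     (\<forall>p1\<in>X - mball p r. \<forall>p2\<in>X - mball p r. \<rho> p1 p2 \<le> \<rho> p1 (pr r p True) + \<rho> p2 (pr r p False))"
    by metis
  interpret regular_shortcut_space X \<rho> D l pr Q C
    by unfold_locales (use D(1) l pr assms(3) C reg small(1) in blast)+
  have "\<not> bilipschitz_equivalent_on A shortcut_dist \<rho>" if "A \<subseteq> X" "hausdorff X \<rho> Q A > 0" for A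
    using bilipschitz_null[OF assms(2) that(1)] that(2) by auto
  then show ?thesis
    using Metric_space_shortcut_dist shortcut_dist_le ahlfors_regular_shortcut_dist by (intro exI[of _ shortcut_dist]) blast
qed

end
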